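(* Let $\mathcal{H}$ be a separable Hilbert space and let $\Phi:=(\varphi_1,\ldots,\varphi_k)$ be a commuting $k$-tuple of positive linear maps on $B(\mathcal{H})$. Then the following statements are equivalent. (i) $r(\varphi_i)<1$ for each $i\in\{1,\ldots,k\}$. (ii) $\Phi$ is jointly similar to a commuting $k$-tuple $\Lambda:=(\lambda_1,\ldots,\lambda_k)$ of positive linear maps on $B(\mathcal{H})$ with $\lambda_i(I)<I$ for any $i\in\{1,\ldots,k\}$. (iii) For each $\mathbf{m}\in\mathbb{N}^k$, $\Phi$ is jointly similar to a commuting $k$-tuple $\Lambda:=(\lambda_1,\ldots,\lambda_k)$ of positive linear maps on $B(\mathcal{H})$ with $I\in\mathcal{C}_{>}(\mathbf{\Delta}_{\Lambda}^{\mathbf{m}})^+$.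
   Context: $\mathbb{N}=\{1,2,\ldots\}$, $\mathbb{Z}_+=\{0,1,\ldots\}$; powers of linear maps are iterates under composition; order on $\mathbb{Z}_+^k$ is coordinatewise. For self-adjoint $A,B$, $A<B$ means $B-A$ is positive and invertible. A $k$-tuple of linear maps is commuting if its entries pairwise commute under composition. The spectral radius of a positive linear map $\varphi$ on $B(\mathcal{H})$ is $r(\varphi):=\lim_{s\to\infty}\|\varphi^s\|^{1/s}$. For a commuting $k$-tuple $\Lambda=(\lambda_1,\ldots,\lambda_k)$ of positive linear maps on $B(\mathcal{H})$ and $\mathbf{p}\in\mathbb{Z}_+^k$, $\mathbf{\Delta}_{\Lambda}^{\mathbf{p}}:=(id-\lambda_1)^{p_1}\circ\cdots\circ(id-\lambda_k)^{p_k}$, and $\mathcal{C}_{>}(\mathbf{\Delta}_{\Lambda}^{\mathbf{m}})^+:=\{X\in B(\mathcal{H}):X\ge0\text{ and }\mathbf{\Delta}_{\Lambda}^{\mathbf{p}}(X)>0\text{ for }0\le\mathbf{p}\le\mathbf{m},\ \mathbf{p}\ne0\}$. $\Phi$ is jointly similar to $\Lambda$ if there is an invertible operator $R\in B(\mathcal{H})$ such that $\varphi_i(RXR^* )=R\lambda_i(X)R^*$ for all $X\in B(\mathcal{H})$ and $i\in\{1,\ldots,k\}$. *)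

theory Defs
  imports "HOL-Analysis.Analysis"
begin

section \<open>Complex Hilbert spaces\<close>

class scaleC =
  fixes scaleC :: "complex \<Rightarrow> 'a \<Rightarrow> 'a" (infixr \<open>*\<^sub>C\<close> 75)

class complex_vector = real_vector + scaleC +
  assumes scaleC_add_right: "c *\<^sub>C (x + y) = c *\<^sub>C x + c *\<^sub>C y"
    and scaleC_add_left: "(c + d) *\<^sub>C x = c *\<^sub>C x + d *\<^sub>C x"
    and scaleC_scaleC: "c *\<^sub>C (d *\<^sub>C x) = (c * d) *\<^sub>C x"
    and scaleR_scaleC: "r *\<^sub>R x = complex_of_real r *\<^sub>C x"

lemma vector_space_scaleC: "vector_space (scaleC :: complex \<Rightarrow> 'a::complex_vector \<Rightarrow> 'a)"
proof
  show "1 *\<^sub>C x = x" for x :: 'a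
    using scaleR_scaleC[of 1 x] by simp
qed (simp_all add: scaleC_add_right scaleC_add_left scaleC_scaleC)

text \<open>
  The inner product is linear in its first argument. Positive definiteness is part of
  \<open>cinner_norm\<close>, since \<^const>\<open>norm\<close> is a norm.
\<close>

class complex_inner = complex_vector + real_normed_vector +
  fixes cinner :: "'a \<Rightarrow> 'a \<Rightarrow> complex"
  assumes cinner_add_left: "cinner (x + y) z = cinner x z + cinner y z"
    and cinner_scaleC_left: "cinner (c *\<^sub>C x) y = c * cinner x y"
    and cinner_commute: "cinner y x = cnj (cinner x y)"
    and cinner_norm: "cinner x x = complex_of_real ((norm x)\<^sup>2)"

class complex_hilbert = complex_inner + complete_space

lemma norm_scaleC: "norm (c *\<^sub>C x) = cmod c * norm (x :: 'a::complex_inner)"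
proof -
  have r: "cinner x (c *\<^sub>C y) = cnj c * cinner x y" for x y :: 'a
    by (metis cinner_commute cinner_scaleC_left complex_cnj_mult complex_cnj_cnj)
  have "complex_of_real ((norm (c *\<^sub>C x))\<^sup>2) = c * cnj c * complex_of_real ((norm x)\<^sup>2)"
    by (simp only: cinner_norm[symmetric] cinner_scaleC_left r mult_ac)
  also have "\<dots> = complex_of_real ((cmod c * norm x)\<^sup>2)"
    by (simp only: complex_norm_square[symmetric] of_real_mult[symmetric] power_mult_distrib)
  finally have "(norm (c *\<^sub>C x))\<^sup>2 = (cmod c * norm x)\<^sup>2"
    by (simp only: of_real_eq_iff)
  then show ?thesis
    by (simp add: power2_eq_iff_nonneg)
qed

lemma bounded_linear_scaleC: "bounded_linear (\<lambda>x :: 'a::complex_inner. c *\<^sub>C x)"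
proof (rule bounded_linear_intro[where K = "cmod c"])
  show "c *\<^sub>C (r *\<^sub>R x) = r *\<^sub>R (c *\<^sub>C x)" for r and x :: 'a
    by (simp add: scaleR_scaleC scaleC_scaleC mult.commute)
qed (simp_all add: scaleC_add_right norm_scaleC mult.commute)


lemmas scaleC_linear = bounded_linear.linear[OF bounded_linear_scaleC]

lemma scaleC_simps [simp]:
  fixes x y :: "'a::complex_inner"
  shows "c *\<^sub>C (0::'a) = 0" "c *\<^sub>C (- x) = - (c *\<^sub>C x)" "c *\<^sub>C (x - y) = c *\<^sub>C x - c *\<^sub>C y"
  using scaleC_linear[of c] by (rule linear_0, rule linear_neg, rule linear_diff)


section \<open>The algebra of bounded operators\<close>

text \<open>
  The type \<^typ>\<open>'a \<Rightarrow>\<^sub>L 'a\<close> consists of the bounded operators that are linear over the reals; those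
  that are linear over the complex numbers are singled out. Products in \<open>'a bop\<close> are compositions and \<open>1\<close> is the
  identity operator; \<open>1 = 0\<close> on the zero space, so this is not an instance of \<^class>\<open>ring_1\<close>.
\<close>

typedef (overloaded) ('a::complex_hilbert) bop =
  "{A :: 'a \<Rightarrow>\<^sub>L 'a. \<forall>c x. blinfun_apply A (c *\<^sub>C x) = c *\<^sub>C blinfun_apply A x}"
  morphisms blinfun_of_bop bop_of_blinfun
proof
  show "0 \<in> {A :: 'a \<Rightarrow>\<^sub>L 'a. \<forall>c x. blinfun_apply A (c *\<^sub>C x) = c *\<^sub>C blinfun_apply A x}"
    by simp
qed

setup_lifting type_definition_bop

lift_definition bop_apply :: "'a::complex_hilbert bop \<Rightarrow> 'a \<Rightarrow> 'a" (infixr \<open>\<odot>\<close> 90)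
  is blinfun_apply .

lemma bop_eqI: "(\<And>x. A \<odot> x = B \<odot> x) \<Longrightarrow> A = B"
  by transfer (auto intro: blinfun_eqI)

instantiation bop :: (complex_hilbert) "{real_normed_algebra, monoid_mult, complex_vector}"
begin

lift_definition zero_bop :: "'a bop" is 0
  by simp

lift_definition one_bop :: "'a bop" is id_blinfun
  by simp

lift_definition plus_bop :: "'a bop \<Rightarrow> 'a bop \<Rightarrow> 'a bop" is "(+)"
  by (simp add: blinfun.add_left scaleC_add_right)

lift_definition uminus_bop :: "'a bop \<Rightarrow> 'a bop" is uminus
  by (simp add: blinfun.minus_left)

lift_definition minus_bop :: "'a bop \<Rightarrow> 'a bop \<Rightarrow> 'a bop" is "(-)"
  by (simp add: blinfun.diff_left)

lift_definition times_bop :: "'a bop \<Rightarrow> 'a bop \<Rightarrow> 'a bop" is blinfun_compose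
  by simp

lift_definition scaleR_bop :: "real \<Rightarrow> 'a bop \<Rightarrow> 'a bop" is scaleR
  by (simp add: blinfun.scaleR_left scaleR_scaleC scaleC_scaleC mult.commute)

lift_definition scaleC_bop :: "complex \<Rightarrow> 'a bop \<Rightarrow> 'a bop"
  is "\<lambda>c A. Blinfun (\<lambda>x. c *\<^sub>C blinfun_apply A x)"
  by (simp add: bounded_linear_Blinfun_apply scaleC_scaleC mult.commute
      bounded_linear_compose[OF bounded_linear_scaleC blinfun.bounded_linear_right])

lift_definition norm_bop :: "'a bop \<Rightarrow> real" is norm .

definition sgn_bop :: "'a bop \<Rightarrow> 'a bop"
  where "sgn_bop A = inverse (norm A) *\<^sub>R A"

definition dist_bop :: "'a bop \<Rightarrow> 'a bop \<Rightarrow> real"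
  where "dist_bop A B = norm (A - B)"

definition uniformity_bop :: "('a bop \<times> 'a bop) filter"
  where "uniformity_bop = (INF e\<in>{0<..}. principal {(A, B). dist A B < e})"

definition open_bop :: "'a bop set \<Rightarrow> bool"
  where "open_bop S = (\<forall>A\<in>S. \<forall>\<^sub>F (A', B) in uniformity. A' = A \<longrightarrow> B \<in> S)"

lemma bop_apply_simps [simp]:
  fixes A B :: "'a bop"
  shows
  "(0 :: 'a bop) \<odot> x = 0"
  "(1 :: 'a bop) \<odot> x = x"
  "(A + B) \<odot> x = A \<odot> x + B \<odot> x"
  "(- A) \<odot> x = - (A \<odot> x)"
  "(A - B) \<odot> x = A \<odot> x - B \<odot> x"
  "(A * B) \<odot> x = A \<odot> B \<odot> x"
  "(r *\<^sub>R A) \<odot> x = r *\<^sub>R (A \<odot> x)"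
  "(c *\<^sub>C A) \<odot> x = c *\<^sub>C (A \<odot> x)"
  by (transfer; simp add: blinfun.bilinear_simps bounded_linear_Blinfun_apply
      bounded_linear_compose[OF bounded_linear_scaleC blinfun.bounded_linear_right])+

instance
proof
  fix A B C :: "'a bop" and a b :: real and c d :: complex
  show "A + B + C = A + (B + C)" by transfer simp
  show "A + B = B + A" by transfer simp
  show "0 + A = A" by transfer simp
  show "- A + A = 0" by transfer simp
  show "A - B = A + - B" by transfer simp
  show "a *\<^sub>R (A + B) = a *\<^sub>R A + a *\<^sub>R B" by transfer (simp add: scaleR_add_right)
  show "(a + b) *\<^sub>R A = a *\<^sub>R A + b *\<^sub>R A" by transfer (simp add: scaleR_add_left)
  show "a *\<^sub>R b *\<^sub>R A = (a * b) *\<^sub>R A" by transfer simp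
  show "1 *\<^sub>R A = A" by transfer simp
  show "A * B * C = A * (B * C)" by transfer (auto intro: blinfun_eqI)
  show "(A + B) * C = A * C + B * C"
    by transfer (auto intro: blinfun_eqI simp: blinfun.bilinear_simps)
  show "A * (B + C) = A * B + A * C"
    by transfer (auto intro: blinfun_eqI simp: blinfun.bilinear_simps)
  show "a *\<^sub>R A * B = a *\<^sub>R (A * B)"
    by transfer (auto intro: blinfun_eqI simp: blinfun.bilinear_simps)
  show "A * a *\<^sub>R B = a *\<^sub>R (A * B)"
    by transfer (auto intro: blinfun_eqI simp: blinfun.bilinear_simps)
  show "1 * A = A" by transfer (auto intro: blinfun_eqI)
  show "A * 1 = A" by transfer (auto intro: blinfun_eqI)
  show "dist A B = norm (A - B)" by (rule dist_bop_def)
  show "(uniformity :: ('a bop \<times> 'a bop) filter) = (INF e\<in>{0<..}. principal {(x, y). dist x y < e})"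
    by (rule uniformity_bop_def)
  show "open U = (\<forall>x\<in>U. \<forall>\<^sub>F (x', y) in uniformity. x' = x \<longrightarrow> y \<in> U)" for U :: "'a bop set"
    by (rule open_bop_def)
  show "sgn A = inverse (norm A) *\<^sub>R A" by (rule sgn_bop_def)
  show "norm A = 0 \<longleftrightarrow> A = 0" by transfer simp
  show "norm (A + B) \<le> norm A + norm B" by transfer (rule norm_triangle_ineq)
  show "norm (a *\<^sub>R A) = \<bar>a\<bar> * norm A" by transfer simp
  show "norm (A * B) \<le> norm A * norm B" by transfer (rule norm_blinfun_compose)
  show "c *\<^sub>C (A + B) = c *\<^sub>C A + c *\<^sub>C B"
    by (rule bop_eqI) (simp add: scaleC_add_right)
  show "(c + d) *\<^sub>C A = c *\<^sub>C A + d *\<^sub>C A"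
    by (rule bop_eqI) (simp add: scaleC_add_left)
  show "c *\<^sub>C d *\<^sub>C A = (c * d) *\<^sub>C A"
    by (rule bop_eqI) (simp add: scaleC_scaleC)
  show "a *\<^sub>R A = complex_of_real a *\<^sub>C A"
    by (rule bop_eqI) (simp add: scaleR_scaleC)
qed

end

lemma norm_bop_onorm: "norm A = onorm (bop_apply A)"
  by transfer (rule norm_blinfun.rep_eq)

text \<open>The Hilbert space adjoint, which exists uniquely by the Riesz representation theorem.\<close>

definition adj :: "'a::complex_hilbert bop \<Rightarrow> 'a bop" where
  "adj A = (THE B. \<forall>x y. cinner (A \<odot> x) y = cinner x (B \<odot> y))"

definition self_adjoint :: "'a::complex_hilbert bop \<Rightarrow> bool" where
  "self_adjoint A \<longleftrightarrow> adj A = A"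

definition positive_op :: "'a::complex_hilbert bop \<Rightarrow> bool" where
  "positive_op A \<longleftrightarrow> (\<forall>x. cinner (A \<odot> x) x \<in> \<real>\<^sub>\<ge>\<^sub>0)"

definition invertible_op :: "'a::complex_hilbert bop \<Rightarrow> bool" where
  "invertible_op A \<longleftrightarrow> (\<exists>B. A * B = 1 \<and> B * A = 1)"

definition op_less :: "'a::complex_hilbert bop \<Rightarrow> 'a bop \<Rightarrow> bool" (infix \<open>\<lless>\<close> 50) where
  "A \<lless> B \<longleftrightarrow> self_adjoint A \<and> self_adjoint B \<and> positive_op (B - A) \<and> invertible_op (B - A)"


section \<open>Tuples of positive linear maps\<close>

definition positive_linear_map :: "('a::complex_hilbert bop \<Rightarrow> 'a bop) \<Rightarrow> bool" where
  "positive_linear_map f \<longleftrightarrow>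
     Vector_Spaces.linear scaleC scaleC f \<and> (\<forall>X. positive_op X \<longrightarrow> positive_op (f X))"

text \<open>Positive linear maps are bounded, so \<^const>\<open>onorm\<close> is their operator norm.\<close>

definition spectral_radius :: "('a::complex_hilbert bop \<Rightarrow> 'a bop) \<Rightarrow> real" where
  "spectral_radius f = lim (\<lambda>s. root s (onorm (f ^^ s)))"

text \<open>
  A \<open>k\<close>-tuple is a function on \<^typ>\<open>nat\<close> of which only the values at \<open>1, \<dots>, k\<close> matter, and
  likewise for multi-indices.
\<close>

definition commuting_positive_tuple ::
  "nat \<Rightarrow> (nat \<Rightarrow> 'a::complex_hilbert bop \<Rightarrow> 'a bop) \<Rightarrow> bool" where
  "commuting_positive_tuple k \<Lambda> \<longleftrightarrow>
     (\<forall>i\<in>{1..k}. positive_linear_map (\<Lambda> i)) \<and>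
     (\<forall>i\<in>{1..k}. \<forall>j\<in>{1..k}. \<Lambda> i \<circ> \<Lambda> j = \<Lambda> j \<circ> \<Lambda> i)"

definition Delta ::
  "nat \<Rightarrow> (nat \<Rightarrow> 'a::complex_hilbert bop \<Rightarrow> 'a bop) \<Rightarrow> (nat \<Rightarrow> nat) \<Rightarrow> 'a bop \<Rightarrow> 'a bop" where
  "Delta k \<Lambda> p = foldr (\<lambda>i f. ((\<lambda>X. X - \<Lambda> i X) ^^ p i) \<circ> f) [1..<Suc k] id"

definition C_greater ::
  "nat \<Rightarrow> (nat \<Rightarrow> 'a::complex_hilbert bop \<Rightarrow> 'a bop) \<Rightarrow> (nat \<Rightarrow> nat) \<Rightarrow> 'a bop set" where
  "C_greater k \<Lambda> m =
     {X. positive_op X \<and>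
         (\<forall>p. (\<forall>i\<in>{1..k}. p i \<le> m i) \<and> (\<exists>i\<in>{1..k}. p i \<noteq> 0) \<longrightarrow> 0 \<lless> Delta k \<Lambda> p X)}"

definition jointly_similar ::
  "nat \<Rightarrow> (nat \<Rightarrow> 'a::complex_hilbert bop \<Rightarrow> 'a bop) \<Rightarrow> (nat \<Rightarrow> 'a bop \<Rightarrow> 'a bop) \<Rightarrow> bool" where
  "jointly_similar k \<Phi> \<Lambda> \<longleftrightarrow>
     (\<exists>R. invertible_op R \<and>
        (\<forall>i\<in>{1..k}. \<forall>X. \<Phi> i (R * X * adj R) = R * \<Lambda> i X * adj R))"

end

theory Submission
  imports Defs
begin

text \<open>
  Suppose all spectral radii are less than \<open>1\<close>. The Neumann series \<open>N\<^sub>i\<close> of \<open>id - \<phi>\<^sub>i\<close> is a positive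
  map with \<open>N\<^sub>i(X) \<ge> X\<close> for \<open>X \<ge> 0\<close>, so that applying each \<open>N\<^sub>i\<close> exactly \<open>m\<^sub>i\<close> times to \<open>I\<close> yields an
  operator \<open>Q\<close> all of whose defects of order \<open>p \<le> m\<close> are at least \<open>I\<close>. Conjugation by \<open>R = \<surd>Q\<close> turns
  \<open>Q\<close> into \<open>I\<close>. Conversely, \<open>\<lambda>(I) < I\<close> means \<open>\<lambda>(I) \<le> q I\<close> for some \<open>q < 1\<close>. Since the norm of a positive
  map is controlled by its value at \<open>I\<close>, the norms of \<open>\<lambda>\<^sup>s\<close>, and hence those of the similar maps
  \<open>\<phi>\<^sup>s\<close>, are \<open>O(q\<^sup>s)\<close>.
\<close>

section \<open>The inner product\<close>

lemma cinner_add_right: "cinner x (y + z) = cinner x y + cinner x (z :: 'a::complex_inner)"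
  by (metis cinner_add_left cinner_commute complex_cnj_add)

lemma cinner_scaleC_right: "cinner x (c *\<^sub>C y) = cnj c * cinner x (y :: 'a::complex_inner)"
  by (metis cinner_commute cinner_scaleC_left complex_cnj_mult)

lemma cinner_scaleR_left: "cinner (r *\<^sub>R x) y = of_real r * cinner x (y :: 'a::complex_inner)"
  by (simp add: scaleR_scaleC cinner_scaleC_left)

lemma cinner_scaleR_right: "cinner x (r *\<^sub>R y) = of_real r * cinner x (y :: 'a::complex_inner)"
  by (simp add: scaleR_scaleC cinner_scaleC_right)

lemma cinner_minus_left: "cinner (- x) y = - cinner x (y :: 'a::complex_inner)"
  using cinner_scaleR_left[of "-1" x y] by simp

lemma cinner_minus_right: "cinner x (- y) = - cinner x (y :: 'a::complex_inner)"
  using cinner_scaleR_right[of x "-1" y] by simp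

lemma cinner_diff_left: "cinner (x - y) z = cinner x z - cinner y (z :: 'a::complex_inner)"
  using cinner_add_left[of x "- y" z] by (simp add: cinner_minus_left)

lemma cinner_diff_right: "cinner x (y - z) = cinner x y - cinner x (z :: 'a::complex_inner)"
  using cinner_add_right[of x y "- z"] by (simp add: cinner_minus_right)

lemma cinner_zero [simp]: "cinner 0 x = 0" "cinner x 0 = 0" for x :: "'a::complex_inner"
  using cinner_scaleR_left[of 0 0 x] cinner_scaleR_right[of x 0 0] by simp_all

lemmas cinner_simps = cinner_add_left cinner_add_right cinner_diff_left cinner_diff_right
  cinner_minus_left cinner_minus_right cinner_scaleR_left cinner_scaleR_right
  cinner_scaleC_left cinner_scaleC_right

lemma norm_add_square:
  "(norm (x + y))\<^sup>2 = (norm x)\<^sup>2 + 2 * Re (cinner x y) + (norm (y :: 'a::complex_inner))\<^sup>2"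
proof -
  have "complex_of_real ((norm (x + y))\<^sup>2) = cinner (x + y) (x + y)"
    by (simp add: cinner_norm)
  also have "\<dots> = cinner x x + (cinner x y + cnj (cinner x y)) + cinner y y"
    by (simp add: cinner_simps cinner_commute[of y x])
  also have "\<dots> = complex_of_real ((norm x)\<^sup>2 + 2 * Re (cinner x y) + (norm y)\<^sup>2)"
    by (simp add: cinner_norm complex_add_cnj)
  finally show ?thesis by (simp only: of_real_eq_iff)
qed

lemma parallelogram_law:
  "(norm (x - y))\<^sup>2 + (norm (x + y))\<^sup>2 = 2 * (norm x)\<^sup>2 + 2 * (norm (y :: 'a::complex_inner))\<^sup>2"
  using norm_add_square[of x y] norm_add_square[of x "- y"] by (simp add: cinner_simps)

lemma cinner_right_eqI: "(\<And>x. cinner x y = cinner x z) \<Longrightarrow> y = (z :: 'a::complex_inner)"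
  by (metis cinner_diff_right cinner_norm eq_iff_diff_eq_0 of_real_eq_0_iff power2_eq_iff_nonneg
      norm_eq_zero zero_eq_power2)

section \<open>Positive operators and the Cauchy--Schwarz inequality\<close>

lemma bop_apply_linear [simp]:
  fixes A :: "'a::complex_hilbert bop"
  shows "A \<odot> (x + y) = A \<odot> x + A \<odot> y" "A \<odot> (x - y) = A \<odot> x - A \<odot> y" "A \<odot> (- x) = - (A \<odot> x)"
    "A \<odot> 0 = 0" "A \<odot> (r *\<^sub>R x) = r *\<^sub>R (A \<odot> x)" "A \<odot> (c *\<^sub>C x) = c *\<^sub>C (A \<odot> x)"
  by (transfer; simp add: blinfun.bilinear_simps)+

lemma norm_bop_apply: "norm (A \<odot> x) \<le> norm A * norm x"
  by transfer (rule norm_blinfun)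

lemma norm_bop_bound: "0 \<le> K \<Longrightarrow> (\<And>x. norm (A \<odot> x) \<le> K * norm x) \<Longrightarrow> norm A \<le> K"
  by transfer (rule norm_blinfun_bound)

lemma positive_op_iff:
  "positive_op A \<longleftrightarrow> (\<forall>x. 0 \<le> Re (cinner (A \<odot> x) x) \<and> Im (cinner (A \<odot> x) x) = 0)"
  by (auto simp: positive_op_def complex_nonneg_Reals_iff)

lemma positive_opD:
  assumes "positive_op A"
  shows "0 \<le> Re (cinner (A \<odot> x) x)" "Im (cinner (A \<odot> x) x) = 0"
    "cinner (A \<odot> x) x = of_real (Re (cinner (A \<odot> x) x))"
  using assms by (auto simp: positive_op_iff complex_eq_iff)

lemma positive_op_0 [simp]: "positive_op 0"
  by (simp add: positive_op_iff)

lemma positive_op_1 [simp]: "positive_op 1"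
  by (simp add: positive_op_iff cinner_norm del: of_real_power)

lemma positive_op_add: "positive_op A \<Longrightarrow> positive_op B \<Longrightarrow> positive_op (A + B)"
  by (auto simp: positive_op_iff cinner_simps)

lemma positive_op_scaleR: "0 \<le> r \<Longrightarrow> positive_op A \<Longrightarrow> positive_op (r *\<^sub>R A)"
  by (auto simp: positive_op_iff cinner_simps)

text \<open>Polarization; this is where the scalars have to be complex.\<close>

lemma positive_op_hermitian:
  assumes "positive_op A"
  shows "cinner (A \<odot> x) y = cinner x (A \<odot> y)"
proof -
  have "Im (cinner (A \<odot> (x + y)) (x + y)) = 0" "Im (cinner (A \<odot> (x + \<i> *\<^sub>C y)) (x + \<i> *\<^sub>C y)) = 0"
    using positive_opD(2)[OF assms] by blast+
  then have "cinner (A \<odot> x) y = cnj (cinner (A \<odot> y) x)"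
    using positive_opD(2)[OF assms, of x] positive_opD(2)[OF assms, of y]
    by (simp add: cinner_simps complex_eq_iff del: cinner_commute)
  then show ?thesis by (metis cinner_commute)
qed

text \<open>The form of \<open>A\<close> may be degenerate, so this is more than the inequality for
  the inner product. Two later uses insert \<open>A \<odot> x\<close>, or a preimage of
  \<open>x\<close>, as one of the vectors and thereby pass from the form to norms.\<close>

lemma positive_op_Cauchy_Schwarz:
  assumes "positive_op A"
  shows "(cmod (cinner (A \<odot> x) y))\<^sup>2 \<le> Re (cinner (A \<odot> x) x) * Re (cinner (A \<odot> y) y)"
proof -
  define z where "z = cinner (A \<odot> x) y"
  define a where "a = Re (cinner (A \<odot> x) x)"
  define b where "b = Re (cinner (A \<odot> y) y)"
  define w where "w = (cmod z)\<^sup>2"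
  have yx: "cinner (A \<odot> y) x = cnj z"
    unfolding z_def positive_op_hermitian[OF assms, of y x] by (rule cinner_commute)
  have w: "of_real w = z * cnj z"
    by (simp only: w_def complex_norm_square)
  have ab: "cinner (A \<odot> x) x = of_real a" "cinner (A \<odot> y) y = of_real b"
    unfolding a_def b_def by (rule positive_opD(3)[OF assms])+
  \<comment> \<open>The form is evaluated at \<open>x - t z y\<close>; the factor \<open>z\<close>
    makes the cross terms real.\<close>
  have quad: "0 \<le> a - 2 * t * w + t\<^sup>2 * w * b" for t
  proof -
    define c where "c = of_real t * z"
    have "cinner (A \<odot> (x - c *\<^sub>C y)) (x - c *\<^sub>C y) =
      of_real a - cnj c * z - c * cnj z + c * cnj c * of_real b"
      by (simp add: cinner_simps ab yx z_def[symmetric] algebra_simps)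
    also have "\<dots> = of_real (a - 2 * t * w + t\<^sup>2 * w * b)"
      by (simp add: c_def w algebra_simps power2_eq_square)
    finally show ?thesis
      using positive_opD(1)[OF assms, of "x - c *\<^sub>C y"] by simp
  qed
  have "b \<ge> 0" unfolding b_def by (rule positive_opD(1)[OF assms])
  have "w \<ge> 0" by (simp add: w_def)
  have "w \<le> a * b"
  proof (cases "b = 0")
    case True
    have "w = 0"
    proof (rule ccontr)
      assume "w \<noteq> 0"
      \<comment> \<open>With \<open>b = 0\<close> the inequality at this \<open>t\<close> reads
        \<open>- a - 2 \<ge> 0\<close>, while \<open>t = 0\<close> gives
        \<open>a \<ge> 0\<close>.\<close>
      then show False using quad[of "(a + 1) / w"] quad[of 0] True by simp
    qed
    then show ?thesis using True by simp
  next
    case False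
    then show ?thesis using quad[of "1 / b"] \<open>b \<ge> 0\<close>
      by (simp add: field_simps power2_eq_square)
  qed
  then show ?thesis by (simp add: w_def a_def b_def z_def)
qed

lemma cinner_Cauchy_Schwarz: "cmod (cinner x y) \<le> norm x * norm (y :: 'a::complex_hilbert)"
  using positive_op_Cauchy_Schwarz[OF positive_op_1, of x y]
  by (simp add: cinner_norm power_mult_distrib[symmetric] power2_le_iff_abs_le del: of_real_power)

text \<open>Cauchy-Schwarz for the form of \<open>A\<close> at \<open>x\<close> and
  \<open>A \<odot> x\<close> suffices, without spectral theory. The construction of square roots
  below relies on this monotonicity of the norm.\<close>

lemma norm_le_if_op_between:
  assumes A: "positive_op A" and BA: "positive_op (B - A)"
  shows "norm A \<le> norm B"
proof (rule norm_bop_bound)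
  have le: "Re (cinner (A \<odot> x) x) \<le> norm B * (norm x)\<^sup>2" for x
  proof -
    have "Re (cinner (A \<odot> x) x) \<le> Re (cinner (B \<odot> x) x)"
      using positive_opD(1)[OF BA, of x] by (simp add: cinner_simps)
    also have "\<dots> \<le> norm (B \<odot> x) * norm x"
      by (meson cinner_Cauchy_Schwarz complex_Re_le_cmod order_trans)
    also have "\<dots> \<le> norm B * norm x * norm x"
      by (intro mult_right_mono norm_bop_apply) simp
    finally show ?thesis by (simp add: power2_eq_square mult.assoc)
  qed
  fix x
  let ?y = "A \<odot> x"
  have "((norm ?y)\<^sup>2)\<^sup>2 \<le> Re (cinner (A \<odot> x) x) * Re (cinner (A \<odot> ?y) ?y)"
    using positive_op_Cauchy_Schwarz[OF A, of x ?y] by (simp add: cinner_norm norm_power)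
  also have "\<dots> \<le> (norm B * (norm x)\<^sup>2) * (norm B * (norm ?y)\<^sup>2)"
    by (intro mult_mono le) (auto simp: positive_opD(1)[OF A])
  finally have "(norm ?y)\<^sup>2 * (norm ?y)\<^sup>2 \<le> (norm B * norm x)\<^sup>2 * (norm ?y)\<^sup>2"
    by (simp add: power2_eq_square mult_ac)
  then have "(norm ?y)\<^sup>2 \<le> (norm B * norm x)\<^sup>2 \<or> norm ?y = 0"
    by (metis mult_right_le_imp_le zero_less_power2)
  then show "norm ?y \<le> norm B * norm x"
    by (auto intro: power2_le_imp_le)
qed simp

section \<open>Riesz representation and adjoints\<close>

text \<open>The representing vector is the minimizer of \<open>\<lambda>x. \<parallel>x\<parallel>\<^sup>2 - 2 Re (f x)\<close>.\<close>

lemma Riesz_representation: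
  fixes f :: "'a::complex_hilbert \<Rightarrow> complex"
  assumes add: "\<And>x y. f (x + y) = f x + f y"
    and scale: "\<And>c x. f (c *\<^sub>C x) = c * f x"
    and bound: "\<And>x. cmod (f x) \<le> K * norm x"
  shows "\<exists>u. \<forall>x. f x = cinner x u"
proof -
  have lin: "bounded_linear f"
    using bound by (intro bounded_linear_intro[where K = K])
      (auto simp: add scale scaleR_scaleC scaleR_conv_of_real mult.commute)
  define J where "J x = (norm x)\<^sup>2 - 2 * Re (f x)" for x
  \<comment> \<open>Completing the square; a lower bound is what gives the infimum \<open>d\<close>
    its meaning.\<close>
  have J_ge: "J x \<ge> - K\<^sup>2" for x
  proof -
    have "Re (f x) \<le> K * norm x"
      using bound[of x] complex_Re_le_cmod[of "f x"] by linarith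
    then show ?thesis unfolding J_def
      using zero_le_power2[of "norm x - K"] by (simp add: power2_diff algebra_simps)
  qed
  define d where "d = Inf (range J)"
  have bdd: "bdd_below (range J)" using J_ge by (intro bdd_belowI2)
  have d_le: "d \<le> J x" for x
    unfolding d_def by (intro cInf_lower bdd) simp
  have "\<exists>x. J x < d + inverse (real (Suc n))" for n
    using cInf_lessD[of "range J" "d + inverse (real (Suc n))"] by (auto simp: d_def)
  then obtain X where X: "\<And>n. J (X n) < d + inverse (real (Suc n))" by metis
  \<comment> \<open>By the parallelogram law, and because \<open>J\<close> at the midpoint is at
    least \<open>d\<close>, any two near-minimizers are close to each other.\<close>
  have dist: "(norm (X m - X n))\<^sup>2 \<le> 2 * inverse (real (Suc m)) + 2 * inverse (real (Suc n))" for m n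
  proof -
    let ?h = "(1/2) *\<^sub>R (X m + X n)"
    have "Re (f ?h) = (Re (f (X m)) + Re (f (X n))) / 2"
      by (simp only: linear_scale[OF bounded_linear.linear[OF lin]] add) simp
    then have "4 * J ?h = (norm (X m + X n))\<^sup>2 - 4 * Re (f (X m)) - 4 * Re (f (X n))"
      by (simp add: J_def power_divide)
    then have "(norm (X m - X n))\<^sup>2 = 2 * J (X m) + 2 * J (X n) - 4 * J ?h"
      using parallelogram_law[of "X m" "X n"] by (simp add: J_def)
    then show ?thesis using d_le[of ?h] X[of m] X[of n] by linarith
  qed
  have "Cauchy X"
  proof (rule metric_CauchyI)
    fix e :: real assume "e > 0"
    then obtain N where N: "inverse (real (Suc N)) < e\<^sup>2 / 4"
      using reals_Archimedean[of "e\<^sup>2 / 4"] by auto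
    have "dist (X m) (X n) < e" if "m \<ge> N" "n \<ge> N" for m n
    proof -
      have "inverse (real (Suc m)) \<le> inverse (real (Suc N))" "inverse (real (Suc n)) \<le> inverse (real (Suc N))"
        using that by (auto intro!: le_imp_inverse_le)
      then have "(norm (X m - X n))\<^sup>2 < e\<^sup>2" using dist[of m n] N by linarith
      then show ?thesis
        unfolding dist_norm by (rule power_less_imp_less_base) (use \<open>e > 0\<close> in simp)
    qed
    then show "\<exists>M. \<forall>m\<ge>M. \<forall>n\<ge>M. dist (X m) (X n) < e" by blast
  qed
  then obtain u where u: "X \<longlonglongrightarrow> u"
    using Cauchy_convergent convergent_def by blast
  have "(\<lambda>n. J (X n)) \<longlonglongrightarrow> J u"
    unfolding J_def by (intro tendsto_intros u bounded_linear.tendsto[OF lin])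
  moreover have "(\<lambda>n. d + inverse (real (Suc n))) \<longlonglongrightarrow> d + 0"
    by (intro tendsto_intros LIMSEQ_inverse_real_of_nat)
  ultimately have "J u \<le> d"
    using X by (auto intro: LIMSEQ_le simp: less_imp_le)
  \<comment> \<open>First variation: at the minimizer the derivative \<open>2 * a\<close> in every
    direction \<open>v\<close> vanishes.\<close>
  have Re_eq: "Re (cinner u v) = Re (f v)" for v
  proof -
    define a where "a = Re (cinner u v) - Re (f v)"
    have quad: "0 \<le> 2 * t * a + t\<^sup>2 * (norm v)\<^sup>2" for t
    proof -
      have "J u \<le> J (u + t *\<^sub>R v)" using \<open>J u \<le> d\<close> d_le order_trans by blast
      then show ?thesis
        unfolding J_def norm_add_square add linear_scale[OF bounded_linear.linear[OF lin]]
        by (simp add: a_def cinner_simps algebra_simps power_mult_distrib)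
    qed
    have "a = 0"
    proof (cases "norm v = 0")
      case True
      then show ?thesis using quad[of 1] quad[of "-1"] by simp
    next
      case False
      then have "a\<^sup>2 \<le> 0" using quad[of "- a / (norm v)\<^sup>2"]
        by (simp add: field_simps power2_eq_square)
      then show ?thesis by simp
    qed
    then show ?thesis by (simp add: a_def)
  qed
  have "f v = cinner v u" for v
  proof -
    \<comment> \<open>Testing the real parts at \<open>v\<close> and at
      \<open>\<i> *\<^sub>C v\<close> also determines the imaginary part.\<close>
    have "cinner u v = cnj (f v)"
      using Re_eq[of v] Re_eq[of "\<i> *\<^sub>C v"] by (simp add: complex_eq_iff cinner_simps scale)
    then show ?thesis by (metis cinner_commute complex_cnj_cnj)
  qed
  then show ?thesis by blast
qed

lemma bop_exI:
  fixes g :: "'a::complex_hilbert \<Rightarrow> 'a"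
  assumes "\<And>x y. g (x + y) = g x + g y" "\<And>c x. g (c *\<^sub>C x) = c *\<^sub>C g x"
    and "\<And>x. norm (g x) \<le> K * norm x"
  shows "\<exists>B. \<forall>x. B \<odot> x = g x"
proof -
  have "bounded_linear g"
    using assms by (intro bounded_linear_intro[where K = K]) (auto simp: scaleR_scaleC mult.commute)
  then show ?thesis using assms(2)
    by (intro exI[of _ "bop_of_blinfun (Blinfun g)"])
      (simp add: bop_apply.rep_eq bop_of_blinfun_inverse bounded_linear_Blinfun_apply)
qed

text \<open>Riesz representation for each fixed \<open>y\<close> gives a vector \<open>g y\<close>;
  the uniqueness of representing vectors makes \<open>g\<close> linear.\<close>

lemma adj_exists: "\<exists>B. \<forall>x y. cinner (A \<odot> x) y = cinner x (B \<odot> y)"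
proof -
  have "\<exists>u. \<forall>x. cinner (A \<odot> x) y = cinner x u" for y
  proof (rule Riesz_representation[where K = "norm A * norm y"])
    show "cmod (cinner (A \<odot> x) y) \<le> norm A * norm y * norm x" for x
      using order_trans[OF cinner_Cauchy_Schwarz mult_right_mono[OF norm_bop_apply], of y A x]
      by (simp add: mult_ac)
  qed (simp_all add: cinner_simps)
  then obtain g where g: "\<And>x y. cinner (A \<odot> x) y = cinner x (g y)" by metis
  have "\<exists>B. \<forall>y. B \<odot> y = g y"
  proof (rule bop_exI[where K = "norm A"])
    show "g (y + z) = g y + g z" for y z
      by (rule cinner_right_eqI) (simp add: g[symmetric] cinner_simps)
    show "g (c *\<^sub>C y) = c *\<^sub>C g y" for c y
      by (rule cinner_right_eqI) (simp add: g[symmetric] cinner_simps)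
    show "norm (g y) \<le> norm A * norm y" for y
    proof -
      have "(norm (g y))\<^sup>2 = cmod (cinner (A \<odot> g y) y)"
        by (simp add: g cinner_norm norm_power)
      also have "\<dots> \<le> norm A * norm (g y) * norm y"
        by (meson cinner_Cauchy_Schwarz mult_right_mono norm_bop_apply norm_ge_zero order_trans)
      finally have "norm (g y) * norm (g y) \<le> (norm A * norm y) * norm (g y)"
        by (simp add: power2_eq_square mult_ac)
      then show ?thesis by (cases "norm (g y) = 0") (auto simp: mult_le_cancel_right)
    qed
  qed
  then show ?thesis using g by metis
qed

text \<open>Unlocks the definite description in \<open>adj\<close>: the rules for products, sums and
  multiples all come from this uniqueness.\<close>

lemma adj_unique:
  assumes "\<And>x y. cinner (A \<odot> x) y = cinner x (B \<odot> y)"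
  shows "adj A = B"
  unfolding adj_def
proof (rule the_equality)
  fix C assume "\<forall>x y. cinner (A \<odot> x) y = cinner x (C \<odot> y)"
  then show "C = B" using assms by (intro bop_eqI cinner_right_eqI) metis
qed (use assms in blast)

lemma cinner_adj_right: "cinner x (adj A \<odot> y) = cinner (A \<odot> x) y"
  using adj_exists[of A] adj_unique[of A] by metis

lemma cinner_adj_left: "cinner (adj A \<odot> x) y = cinner x (A \<odot> y)"
  by (metis cinner_adj_right cinner_commute)

lemma adj_adj [simp]: "adj (adj A) = A"
  by (rule adj_unique) (simp add: cinner_adj_left)

lemma adj_mult: "adj (A * B) = adj B * adj A"
  by (rule adj_unique) (simp add: cinner_adj_right)

lemma adj_1 [simp]: "adj 1 = 1"
  by (rule adj_unique) simp

lemma adj_add: "adj (A + B) = adj A + adj B"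
  by (rule adj_unique) (simp add: cinner_adj_right cinner_simps)

lemma adj_diff: "adj (A - B) = adj A - adj B"
  by (rule adj_unique) (simp add: cinner_adj_right cinner_simps)

lemma adj_scaleC: "adj (c *\<^sub>C A) = cnj c *\<^sub>C adj A"
  by (rule adj_unique) (simp add: cinner_adj_right cinner_simps)

lemma adj_scaleR: "adj (r *\<^sub>R A) = r *\<^sub>R adj A"
  by (simp add: scaleR_scaleC adj_scaleC)

text \<open>Rests on \<open>cinner (A \<odot> z) y\<close> being the squared norm of
  \<open>z = adj A \<odot> y\<close>. It makes \<open>adj\<close> continuous, so that
  self-adjointness survives limits.\<close>

lemma norm_adj_le: "norm (adj A) \<le> norm A"
proof (rule norm_bop_bound)
  fix y
  let ?z = "adj A \<odot> y"
  have "(norm ?z)\<^sup>2 = cmod (cinner (A \<odot> ?z) y)"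
    by (simp add: cinner_adj_right[symmetric] cinner_norm norm_power)
  also have "\<dots> \<le> norm A * norm ?z * norm y"
    by (meson cinner_Cauchy_Schwarz mult_right_mono norm_bop_apply norm_ge_zero order_trans)
  finally have "norm ?z * norm ?z \<le> (norm A * norm y) * norm ?z"
    by (simp add: power2_eq_square mult_ac)
  then show "norm ?z \<le> norm A * norm y"
    by (cases "norm ?z = 0") (auto simp: mult_le_cancel_right)
qed simp

lemma bounded_linear_adj: "bounded_linear (adj :: 'a::complex_hilbert bop \<Rightarrow> 'a bop)"
  by (rule bounded_linear_intro[where K = 1]) (simp_all add: adj_add adj_scaleR norm_adj_le)

lemma positive_op_imp_self_adjoint: "positive_op A \<Longrightarrow> self_adjoint A"
  unfolding self_adjoint_def by (rule adj_unique) (rule positive_op_hermitian)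

lemma positive_op_conjugate: "positive_op A \<Longrightarrow> positive_op (R * A * adj R)"
  unfolding positive_op_def by (metis bop_apply_simps(6) cinner_adj_right)

section \<open>Completeness, inverses and square roots\<close>

instance complex_hilbert \<subseteq> banach ..

text \<open>The limit is taken among the bounded real-linear maps, which form a complete space;
  complex homogeneity passes to the limit. The fixed-point arguments below need this
  completeness.\<close>

instance bop :: (complex_hilbert) banach
proof
  fix X :: "nat \<Rightarrow> 'a bop"
  assume "Cauchy X"
  have dist: "dist (blinfun_of_bop A) (blinfun_of_bop B) = dist A B" for A B :: "'a bop"
    by (simp add: dist_norm norm_bop.rep_eq minus_bop.rep_eq)
  have "Cauchy (\<lambda>n. blinfun_of_bop (X n))"
    using \<open>Cauchy X\<close> by (simp add: Cauchy_def dist)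
  then obtain A where A: "(\<lambda>n. blinfun_of_bop (X n)) \<longlonglongrightarrow> A"
    by (auto dest!: Cauchy_convergent simp: convergent_def)
  have lim: "(\<lambda>n. X n \<odot> x) \<longlonglongrightarrow> blinfun_apply A x" for x
    unfolding bop_apply.rep_eq by (intro tendsto_intros A)
  have "blinfun_apply A (c *\<^sub>C x) = c *\<^sub>C blinfun_apply A x" for c x
    using bounded_linear.tendsto[OF bounded_linear_scaleC[of c] lim[of x]] lim[of "c *\<^sub>C x"]
    by (auto intro: LIMSEQ_unique)
  then have "blinfun_of_bop (bop_of_blinfun A) = A"
    by (simp add: bop_of_blinfun_inverse)
  then have "X \<longlonglongrightarrow> bop_of_blinfun A"
    using A by (simp add: tendsto_dist_iff[of X] tendsto_dist_iff[of _ A] flip: dist)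
  then show "convergent X" by (auto simp: convergent_def)
qed

lemmas module_scaleC = vector_space_scaleC[folded module_iff_vector_space]

text \<open>Only an inequality, since \<open>1 = 0\<close> on the zero space.\<close>

lemma norm_one_bop_le: "norm (1 :: 'a::complex_hilbert bop) \<le> 1"
  by (rule norm_bop_bound) simp_all

section \<open>Inverses of operators\<close>

lemma invertible_op_mult:
  assumes "invertible_op A" "invertible_op B"
  shows "invertible_op (A * B)"
proof -
  obtain A' B' where *: "A * A' = 1" "A' * A = 1" "B * B' = 1" "B' * B = 1"
    using assms by (auto simp: invertible_op_def)
  have "A * B * (B' * A') = A * (B * B') * A'" "B' * A' * (A * B) = B' * (A' * A) * B"
    by (simp_all only: mult.assoc)
  then show ?thesis unfolding invertible_op_def using * by (intro exI[of _ "B' * A'"]) simp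
qed

lemma invertible_op_adj: "invertible_op A \<Longrightarrow> invertible_op (adj A)"
  unfolding invertible_op_def by (metis (no_types) adj_mult adj_1)

lemma invertible_op_scaleR:
  assumes "r \<noteq> 0" "invertible_op A"
  shows "invertible_op (r *\<^sub>R A)"
proof -
  obtain B where "A * B = 1" "B * A = 1" using assms by (auto simp: invertible_op_def)
  then show ?thesis
    unfolding invertible_op_def using assms by (intro exI[of _ "inverse r *\<^sub>R B"]) simp
qed

text \<open>The maps \<open>Z \<mapsto> 1 + T * Z\<close> and \<open>Z \<mapsto> 1 + Z * T\<close>
  are contractions; their fixed points are a right and a left inverse, and these coincide.\<close>

lemma invertible_op_one_minus:
  fixes T :: "'a::complex_hilbert bop"
  assumes "norm T < 1"
  shows "invertible_op (1 - T)"
proof -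
  have "\<exists>!Z. 1 + T * Z = Z"
    using assms
    by (intro banach_fix_type[where c = "norm T"])
      (auto simp: dist_norm norm_mult_ineq right_diff_distrib[symmetric])
  then obtain Z where Z: "1 + T * Z = Z" by blast
  have "\<exists>!Z. 1 + Z * T = Z"
    using assms
    by (intro banach_fix_type[where c = "norm T"])
      (auto simp: dist_norm left_diff_distrib[symmetric] mult.commute[of "norm T"] norm_mult_ineq)
  then obtain Z' where Z': "1 + Z' * T = Z'" by blast
  have "(1 - T) * Z = 1" "Z' * (1 - T) = 1"
    using Z Z' by (simp_all add: left_diff_distrib right_diff_distrib algebra_simps)
  moreover have "Z' = Z"
    using calculation by (metis mult.assoc mult_1_left mult_1_right)
  ultimately show ?thesis unfolding invertible_op_def by blast
qed

lemma self_adjoint_norm_bounds: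
  assumes "self_adjoint A"
  shows "positive_op (norm A *\<^sub>R 1 - A)" "positive_op (norm A *\<^sub>R 1 + A)"
proof -
  have im: "Im (cinner (A \<odot> x) x) = 0" for x
    using cinner_adj_left[of A x x] cinner_commute[of "A \<odot> x" x] assms
    by (simp add: self_adjoint_def complex_eq_iff)
  have re: "\<bar>Re (cinner (A \<odot> x) x)\<bar> \<le> norm A * (norm x)\<^sup>2" for x
  proof -
    have "\<bar>Re (cinner (A \<odot> x) x)\<bar> \<le> norm (A \<odot> x) * norm x"
      by (meson cinner_Cauchy_Schwarz abs_Re_le_cmod order_trans)
    also have "\<dots> \<le> norm A * norm x * norm x"
      by (intro mult_right_mono norm_bop_apply) simp
    finally show ?thesis by (simp add: power2_eq_square mult.assoc)
  qed
  show "positive_op (norm A *\<^sub>R 1 - A)" "positive_op (norm A *\<^sub>R 1 + A)"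
    unfolding positive_op_iff
    using re im by (simp_all add: cinner_simps cinner_norm abs_le_iff minus_le_iff
        add.commute[of "norm A * _"] flip: diff_le_eq del: of_real_power)
qed

text \<open>
  With \<open>P = c (1 - T)\<close>, the square root is \<open>\<surd>c (1 - Y)\<close> for the fixed point \<open>Y\<close> of
  \<open>Y \<mapsto> (T + Y\<^sup>2) / 2\<close>, which is a contraction of a ball of radius less than \<open>1\<close>.
\<close>

lemma positive_op_square_root:
  fixes P :: "'a::complex_hilbert bop"
  assumes "\<delta> > 0" and lower: "positive_op (P - \<delta> *\<^sub>R 1)"
  obtains R where "self_adjoint R" "invertible_op R" "R * R = P"
proof -
  have P: "positive_op P"
    using positive_op_add[OF lower positive_op_scaleR[OF _ positive_op_1, of \<delta>]] assms by simp
  \<comment> \<open>\<open>P \<le> c\<close> gives \<open>T \<ge> 0\<close>, and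
    \<open>\<delta> \<le> P\<close> gives \<open>T \<le> q\<close> with
    \<open>0 \<le> q < 1\<close>.\<close>
  define c where "c = norm P + \<delta>"
  have c: "c > 0" "\<delta> \<le> c" unfolding c_def using assms by (simp_all add: add_nonneg_pos)
  define T where "T = 1 - (1 / c) *\<^sub>R P"
  define q where "q = 1 - \<delta> / c"
  \<comment> \<open>The smaller root of \<open>q + \<rho>\<^sup>2 = 2 * \<rho>\<close>: the
    iteration then maps the ball of radius \<open>\<rho>\<close> into itself and has contraction
    constant \<open>\<rho>\<close>.\<close>
  define \<rho> where "\<rho> = 1 - sqrt (1 - q)"
  have q: "0 \<le> q" "q < 1" unfolding q_def using assms c by auto
  then have \<rho>: "0 \<le> \<rho>" "\<rho> < 1" "q + \<rho>\<^sup>2 = 2 * \<rho>"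
    unfolding \<rho>_def by (auto simp: power2_diff)
  have "positive_op ((1 / c) *\<^sub>R ((norm P *\<^sub>R 1 - P) + \<delta> *\<^sub>R 1))"
    using assms c
    by (intro positive_op_scaleR positive_op_add self_adjoint_norm_bounds positive_op_1
        positive_op_imp_self_adjoint P) auto
  also have "(1 / c) *\<^sub>R ((norm P *\<^sub>R 1 - P) + \<delta> *\<^sub>R 1) = (1 / c) *\<^sub>R (c *\<^sub>R 1 - P)"
    by (simp add: c_def scaleR_add_left)
  also have "\<dots> = T"
    using c by (simp add: T_def scaleR_diff_right)
  finally have T: "positive_op T" .
  have "q *\<^sub>R 1 - T = (1 / c) *\<^sub>R (P - \<delta> *\<^sub>R 1)"
    by (simp add: q_def T_def scaleR_diff_right scaleR_diff_left)
  then have "positive_op (q *\<^sub>R 1 - T)"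
    using lower c by (simp add: positive_op_scaleR)
  then have "norm T \<le> norm (q *\<^sub>R 1 :: 'a bop)"
    by (rule norm_le_if_op_between[OF T])
  also have "\<dots> \<le> q"
    using mult_left_mono[OF norm_one_bop_le q(1)] q by simp
  finally have norm_T: "norm T \<le> q" .
  \<comment> \<open>Self-adjointness is built into the domain, so that the fixed point inherits
    it.\<close>
  define B where "B = {Y :: 'a bop. adj Y = Y \<and> norm Y \<le> \<rho>}"
  have "closed B"
    unfolding B_def using bounded_linear_adj
    by (intro closed_Collect_conj closed_Collect_eq closed_Collect_le continuous_intros
        linear_continuous_on)
  then have "complete B" by (simp add: complete_eq_closed)
  have half: "norm ((1/2) *\<^sub>R X) = norm X / 2" for X :: "'a bop" by simp
  have "\<exists>!Y\<in>B. (1/2) *\<^sub>R (T + Y * Y) = Y"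
  proof (rule Banach_fix[OF \<open>complete B\<close> _ \<rho>(1,2)])
    show "B \<noteq> {}"
      using \<rho> by (auto simp: B_def intro!: exI[of _ 0] adj_unique)
    show "(\<lambda>Y. (1/2) *\<^sub>R (T + Y * Y)) ` B \<subseteq> B"
    proof safe
      fix Y assume Y: "Y \<in> B"
      have "norm (T + Y * Y) \<le> q + \<rho> * \<rho>"
        using Y \<rho>(1) norm_T unfolding B_def mem_Collect_eq
        by (intro order_trans[OF norm_triangle_ineq] add_mono order_trans[OF norm_mult_ineq] mult_mono) auto
      also have "\<dots> = 2 * \<rho>" using \<rho>(3) by (simp add: power2_eq_square)
      finally have "norm (T + Y * Y) \<le> 2 * \<rho>" .
      then show "(1/2) *\<^sub>R (T + Y * Y) \<in> B"
        using Y positive_op_imp_self_adjoint[OF T]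
        by (simp add: B_def half adj_scaleR adj_add adj_mult self_adjoint_def)
    qed
    fix Y Z assume YZ: "Y \<in> B" "Z \<in> B"
    have "dist ((1/2) *\<^sub>R (T + Y * Y)) ((1/2) *\<^sub>R (T + Z * Z)) = norm ((1/2) *\<^sub>R (Y * Y - Z * Z))"
      by (simp only: dist_norm scaleR_diff_right[symmetric] add_diff_cancel_left)
    \<comment> \<open>\<open>Y\<close> and \<open>Z\<close> need not commute, hence this splitting
      of the difference of squares.\<close>
    also have "\<dots> = norm (Y * (Y - Z) + (Y - Z) * Z) / 2"
      unfolding half by (simp add: left_diff_distrib right_diff_distrib)
    also have "norm (Y * (Y - Z) + (Y - Z) * Z) \<le> \<rho> * norm (Y - Z) + norm (Y - Z) * \<rho>"
      using YZ \<rho>(1) unfolding B_def mem_Collect_eq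
      by (intro order_trans[OF norm_triangle_ineq] add_mono order_trans[OF norm_mult_ineq] mult_mono) auto
    finally show "dist ((1/2) *\<^sub>R (T + Y * Y)) ((1/2) *\<^sub>R (T + Z * Z)) \<le> \<rho> * dist Y Z"
      by (simp add: dist_norm)
  qed
  then obtain Y where Y: "adj Y = Y" "norm Y \<le> \<rho>" and fixpt: "(1/2) *\<^sub>R (T + Y * Y) = Y"
    by (auto simp: B_def)
  have "T + Y * Y = 2 *\<^sub>R ((1/2) *\<^sub>R (T + Y * Y))" by simp
  also have "\<dots> = Y + Y" by (simp only: fixpt) (simp add: scaleR_2)
  finally have TY: "T + Y * Y = Y + Y" .
  have "(1 - Y) * (1 - Y) = 1 - (Y + Y) + Y * Y"
    by (simp add: left_diff_distrib right_diff_distrib algebra_simps)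
  also have "\<dots> = 1 - T" by (simp add: TY[symmetric])
  finally have sq: "(1 - Y) * (1 - Y) = (1 / c) *\<^sub>R P" by (simp add: T_def)
  show ?thesis
  proof
    show "self_adjoint (sqrt c *\<^sub>R (1 - Y))"
      by (simp add: self_adjoint_def adj_scaleR adj_diff Y)
    show "invertible_op (sqrt c *\<^sub>R (1 - Y))"
      using c Y \<rho> by (intro invertible_op_scaleR invertible_op_one_minus) auto
    show "(sqrt c *\<^sub>R (1 - Y)) * (sqrt c *\<^sub>R (1 - Y)) = P"
      using c by (simp add: sq)
  qed
qed

text \<open>For an inverse \<open>B\<close> of \<open>P\<close>, Cauchy-Schwarz for the form of
  \<open>P\<close> at \<open>B \<odot> x\<close> and \<open>x\<close> bounds the squared norm of
  \<open>x\<close> by \<open>norm B\<close> times the form at \<open>x\<close>. This turns the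
  strict order into a uniform gap.\<close>

lemma positive_invertible_lower_bound:
  assumes P: "positive_op P" and "invertible_op P"
  obtains \<delta> where "\<delta> > 0" "positive_op (P - \<delta> *\<^sub>R 1)"
proof -
  obtain B where B: "P * B = 1" using assms by (auto simp: invertible_op_def)
  \<comment> \<open>The summand 1 guards against \<open>norm B = 0\<close>, which happens on the
    zero space.\<close>
  let ?\<delta> = "1 / (norm B + 1)"
  have pos: "norm B + 1 > 0" by (simp add: add_nonneg_pos)
  have "?\<delta> * (norm x)\<^sup>2 \<le> Re (cinner (P \<odot> x) x)" for x
  proof -
    let ?r = "Re (cinner (P \<odot> x) x)"
    have PB: "P \<odot> B \<odot> x = x" by (metis B bop_apply_simps(2,6))
    have r: "?r \<ge> 0" by (rule positive_opD(1)[OF P])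
    have "((norm x)\<^sup>2)\<^sup>2 \<le> Re (cinner x (B \<odot> x)) * ?r"
      using positive_op_Cauchy_Schwarz[OF P, of "B \<odot> x" x] by (simp add: PB cinner_norm norm_power)
    also have "Re (cinner x (B \<odot> x)) \<le> norm x * norm (B \<odot> x)"
      by (meson cinner_Cauchy_Schwarz complex_Re_le_cmod order_trans)
    also have "\<dots> \<le> norm x * (norm B * norm x)"
      by (intro mult_left_mono norm_bop_apply) simp
    finally have "(norm x)\<^sup>2 * (norm x)\<^sup>2 \<le> (norm B * ?r) * (norm x)\<^sup>2"
      using r by (simp add: power2_eq_square mult_right_mono mult_ac)
    then have "(norm x)\<^sup>2 \<le> norm B * ?r"
      using r by (cases "x = 0") (auto intro: mult_right_le_imp_le[of _ "(norm x)\<^sup>2"])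
    then show ?thesis using pos r by (simp add: field_simps)
  qed
  then have "positive_op (P - ?\<delta> *\<^sub>R 1)"
    using positive_opD(2)[OF P]
    by (simp add: positive_op_iff cinner_simps cinner_norm del: of_real_power)
  with pos show ?thesis by (intro that[of ?\<delta>]) simp_all
qed

text \<open>Such a \<open>P\<close> is the square of an invertible operator.\<close>

lemma invertible_op_if_bounded_below:
  assumes "\<delta> > 0" "positive_op (P - \<delta> *\<^sub>R 1)"
  shows "invertible_op P"
  by (rule positive_op_square_root[OF assms]) (use invertible_op_mult in blast)

lemma op_less_0_iff: "0 \<lless> A \<longleftrightarrow> positive_op A \<and> invertible_op A"
  using positive_op_imp_self_adjoint[of A] positive_op_imp_self_adjoint[OF positive_op_0]
  by (auto simp: op_less_def)

section \<open>Positive linear maps are bounded\<close>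

lemma positive_linear_mapI:
  assumes "\<And>X Y. f (X + Y) = f X + f Y" "\<And>c X. f (c *\<^sub>C X) = c *\<^sub>C f X"
    and "\<And>X. positive_op X \<Longrightarrow> positive_op (f X)"
  shows "positive_linear_map f"
  using assms by (simp add: positive_linear_map_def Vector_Spaces.linear_iff vector_space_scaleC)

lemma positive_linear_mapD:
  assumes "positive_linear_map f"
  shows "f (X + Y) = f X + f Y" "f (c *\<^sub>C X) = c *\<^sub>C f X" "f (r *\<^sub>R X) = r *\<^sub>R f X"
    "positive_op X \<Longrightarrow> positive_op (f X)"
  using assms by (auto simp: positive_linear_map_def Vector_Spaces.linear_iff scaleR_scaleC)

lemma positive_linear_map_diff:
  assumes "positive_linear_map f"
  shows "f (X - Y) = f X - f Y"
  using positive_linear_mapD(1)[OF assms, of "X - Y" Y] by (simp add: algebra_simps)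

lemma positive_linear_map_funpow: "positive_linear_map f \<Longrightarrow> positive_linear_map (f ^^ n)"
  by (induction n) (auto intro!: positive_linear_mapI simp: positive_linear_mapD)

lemma norm_scaleC_bop_le: "norm (c *\<^sub>C A) \<le> cmod c * norm (A :: 'a::complex_hilbert bop)"
  by (rule norm_bop_bound) (simp_all add: norm_scaleC norm_bop_apply mult_left_mono mult.assoc)

text \<open>With \<open>c = norm A\<close>, the bounds \<open>- c \<le> A \<le> c\<close> give
  \<open>0 \<le> f (c + A) \<le> 2 c f(1)\<close>; subtracting \<open>c f(1)\<close> costs one more
  multiple, hence the factor 3.\<close>

lemma positive_linear_map_self_adjoint_bound:
  assumes f: "positive_linear_map f" and A: "self_adjoint A"
  shows "norm (f A) \<le> 3 * norm (f 1) * norm A"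
proof -
  let ?c = "norm A"
  have "positive_op (f (?c *\<^sub>R 1 + A))"
    by (intro positive_linear_mapD(4)[OF f] self_adjoint_norm_bounds A)
  moreover have "(2 * ?c) *\<^sub>R f 1 - f (?c *\<^sub>R 1 + A) = f (?c *\<^sub>R 1 - A)"
    by (simp add: positive_linear_mapD[OF f] positive_linear_map_diff[OF f] algebra_simps
        flip: scaleR_2)
  then have "positive_op ((2 * ?c) *\<^sub>R f 1 - f (?c *\<^sub>R 1 + A))"
    by (simp add: positive_linear_mapD(4)[OF f] self_adjoint_norm_bounds A)
  ultimately have "norm (f (?c *\<^sub>R 1 + A)) \<le> norm ((2 * ?c) *\<^sub>R f 1)"
    by (rule norm_le_if_op_between)
  then have "norm (?c *\<^sub>R f 1 + f A) \<le> 2 * ?c * norm (f 1)"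
    by (simp add: positive_linear_mapD[OF f])
  moreover have "norm (f A) \<le> norm (?c *\<^sub>R f 1 + f A) + norm (?c *\<^sub>R f 1)"
    using norm_triangle_ineq4[of "?c *\<^sub>R f 1 + f A" "?c *\<^sub>R f 1"] by simp
  ultimately show ?thesis by (simp add: mult_ac)
qed

text \<open>Splitting \<open>X\<close> into self-adjoint real and imaginary parts, each of norm at
  most \<open>norm X\<close>, doubles the constant 3. The growth of the powers of a positive map can
  thus be read off at \<open>1\<close>.\<close>

lemma positive_linear_map_bound:
  assumes f: "positive_linear_map f"
  shows "norm (f X) \<le> 6 * norm (f 1) * norm X"
proof -
  define A where "A = (1/2) *\<^sub>R (X + adj X)"
  define B where "B = (- \<i> / 2) *\<^sub>C (X - adj X)"
  have "self_adjoint A"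
    by (simp add: self_adjoint_def A_def adj_scaleR adj_add add.commute)
  have "self_adjoint B"
    unfolding self_adjoint_def B_def adj_scaleC adj_diff
    by (simp add: module.scale_minus_left[OF module_scaleC]
        module.scale_right_diff_distrib[OF module_scaleC])
  have X: "X = A + \<i> *\<^sub>C B"
    unfolding A_def B_def
    by (rule bop_eqI) (simp add: scaleC_scaleC scaleR_scaleC scaleC_add_right
        vector_space.vector_space_assms(4)[OF vector_space_scaleC] flip: scaleC_add_left)
  have adj: "norm (X + adj X) \<le> 2 * norm X" "norm (X - adj X) \<le> 2 * norm X"
    using norm_adj_le[of X] norm_triangle_ineq[of X "adj X"] norm_triangle_ineq4[of X "adj X"]
    by linarith+
  have "norm A \<le> norm X" using adj by (simp add: A_def)
  moreover have "norm B \<le> norm X"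
    using adj norm_scaleC_bop_le[of "- \<i> / 2" "X - adj X"] by (simp add: B_def norm_divide)
  ultimately have "norm (f A) \<le> 3 * norm (f 1) * norm X" "norm (f B) \<le> 3 * norm (f 1) * norm X"
    using \<open>self_adjoint A\<close> \<open>self_adjoint B\<close>
    by (auto intro!: order_trans[OF positive_linear_map_self_adjoint_bound[OF f]] mult_left_mono)
  moreover have "norm (f X) \<le> norm (f A) + norm (f B)"
  proof -
    have "f X = f A + \<i> *\<^sub>C f B"
      by (subst X) (simp only: positive_linear_mapD[OF f])
    then show ?thesis
      using norm_triangle_ineq[of "f A" "\<i> *\<^sub>C f B"] norm_scaleC_bop_le[of \<i> "f B"] by simp
  qed
  ultimately show ?thesis by linarith
qed

lemma positive_linear_map_bounded_linear: "positive_linear_map f \<Longrightarrow> bounded_linear f"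
  using positive_linear_map_bound[of f]
  by (intro bounded_linear_intro[where K = "6 * norm (f 1)"])
    (auto simp: positive_linear_mapD mult_ac)

section \<open>The spectral radius of a positive linear map\<close>

text \<open>Fekete's lemma in multiplicative form.\<close>

lemma submultiplicative_root_convergent:
  fixes a :: "nat \<Rightarrow> real"
  assumes nonneg: "\<And>n. 0 \<le> a n" and mult: "\<And>m n. a (m + n) \<le> a m * a n"
  shows "convergent (\<lambda>n. root n (a n))"
proof -
  define L where "L = Inf ((\<lambda>n. root n (a n)) ` {1..})"
  have bdd: "bdd_below ((\<lambda>n. root n (a n)) ` {1..})"
    using nonneg by (intro bdd_belowI2[where m = 0]) simp
  have L_le: "L \<le> root n (a n)" if "n \<ge> 1" for n
    unfolding L_def using that by (intro cInf_lower bdd) auto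
  have "L \<ge> 0"
    unfolding L_def using nonneg by (intro cInf_greatest) auto
  have "(\<lambda>n. root n (a n)) \<longlonglongrightarrow> L"
  proof (rule order_tendstoI)
    fix y assume "y < L"
    then show "\<forall>\<^sub>F n in sequentially. y < root n (a n)"
      using L_le by (intro eventually_sequentiallyI[of 1]) (auto intro: less_le_trans)
  next
    fix y assume "L < y"
    then obtain c where c: "L < c" "c < y" using dense by blast
    then have "c > 0" using \<open>L \<ge> 0\<close> by simp
    obtain m where m: "m \<ge> 1" "root m (a m) < c"
      using cInf_lessD[of "(\<lambda>n. root n (a n)) ` {1..}" c] c by (auto simp: L_def)
    have "root m (a m) ^ m \<le> c ^ m"
      using m nonneg by (intro power_mono) auto
    then have am: "a m \<le> c ^ m" using m nonneg by (simp add: real_root_pow_pos2)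
    \<comment> \<open>The sum covers the finitely many remainders modulo \<open>m\<close>; the
      summand 1 makes \<open>K\<close> positive, so that its roots tend to 1.\<close>
    define K where "K = 1 + (\<Sum>r<m. a r / c ^ r)"
    have "K > 0" unfolding K_def using nonneg \<open>c > 0\<close>
      by (intro add_pos_nonneg sum_nonneg) auto
    \<comment> \<open>Blocks of length \<open>m\<close> are split off, each contributing at most
      \<open>c ^ m\<close>, until a remainder below \<open>m\<close> is left.\<close>
    have K: "a n \<le> K * c ^ n" for n
    proof (induction n rule: less_induct)
      case (less n)
      show ?case
      proof (cases "n < m")
        case True
        have "a n / c ^ n \<le> (\<Sum>r<m. a r / c ^ r)"
          using True nonneg \<open>c > 0\<close> by (intro member_le_sum) auto
        then show ?thesis using \<open>c > 0\<close> by (simp add: K_def field_simps add_increasing)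
      next
        case False
        then have "a n \<le> a m * a (n - m)" using mult[of m "n - m"] by simp
        also have "\<dots> \<le> c ^ m * (K * c ^ (n - m))"
          using am less[of "n - m"] m False nonneg \<open>c > 0\<close> by (intro mult_mono) auto
        also have "\<dots> = K * (c ^ m * c ^ (n - m))" by simp
        also have "c ^ m * c ^ (n - m) = c ^ n" using False by (simp flip: power_add)
        finally show ?thesis .
      qed
    qed
    have "(\<lambda>n. root n K * c) \<longlonglongrightarrow> 1 * c"
      by (intro tendsto_intros LIMSEQ_root_const \<open>K > 0\<close>)
    then have "\<forall>\<^sub>F n in sequentially. root n K * c < y"
      using c by (intro order_tendstoD) auto
    then show "\<forall>\<^sub>F n in sequentially. root n (a n) < y"
      using eventually_ge_at_top[of 1]
    proof eventually_elim
      case (elim n)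
      have "root n (a n) \<le> root n (K * c ^ n)"
        using elim K by (intro real_root_le_mono) auto
      also have "\<dots> = root n K * c"
        using elim \<open>c > 0\<close> by (simp add: real_root_mult real_root_power_cancel)
      finally show ?case using elim by simp
    qed
  qed
  then show ?thesis by (auto simp: convergent_def)
qed

lemma bounded_linear_funpow:
  fixes f :: "'a::real_normed_vector \<Rightarrow> 'a"
  assumes "bounded_linear f"
  shows "bounded_linear (f ^^ n)"
  by (induction n) (auto simp: id_def o_def bounded_linear_ident
      intro: bounded_linear_compose[OF assms])

text \<open>\<open>lim\<close> is informative only for convergent sequences; convergence holds
  because \<open>onorm\<close> is submultiplicative on powers.\<close>

lemma spectral_radius_LIMSEQ:
  assumes "bounded_linear f"
  shows "(\<lambda>s. root s (onorm (f ^^ s))) \<longlonglongrightarrow> spectral_radius f"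
proof -
  have "convergent (\<lambda>s. root s (onorm (f ^^ s)))"
    by (intro submultiplicative_root_convergent onorm_pos_le)
      (auto simp: funpow_add intro: onorm_compose bounded_linear_funpow assms)
  then show ?thesis by (simp add: spectral_radius_def convergent_LIMSEQ_iff)
qed

text \<open>The roots of the constant \<open>K\<close> tend to 1, which is why a change by
  similarity does no harm.\<close>

lemma spectral_radius_le:
  assumes f: "bounded_linear f" and "K > 0" "q \<ge> 0"
    and bound: "\<And>s X. norm ((f ^^ s) X) \<le> K * q ^ s * norm X"
  shows "spectral_radius f \<le> q"
proof (rule LIMSEQ_le)
  show "(\<lambda>s. root s (onorm (f ^^ s))) \<longlonglongrightarrow> spectral_radius f"
    by (rule spectral_radius_LIMSEQ[OF f])
  have "(\<lambda>s. root s K * q) \<longlonglongrightarrow> 1 * q"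
    by (intro tendsto_intros LIMSEQ_root_const \<open>K > 0\<close>)
  then show "(\<lambda>s. root s K * q) \<longlonglongrightarrow> q" by simp
  have "root s (onorm (f ^^ s)) \<le> root s K * q" if "s \<ge> 1" for s
  proof -
    have "root s (onorm (f ^^ s)) \<le> root s (K * q ^ s)"
      using that assms by (intro real_root_le_mono onorm_bound bound) auto
    also have "\<dots> = root s K * q"
      using that assms by (simp add: real_root_mult real_root_power_cancel)
    finally show ?thesis .
  qed
  then show "\<exists>N. \<forall>n\<ge>N. root n (onorm (f ^^ n)) \<le> root n K * q" by blast
qed

text \<open>The root test, by comparison with a geometric series whose ratio lies strictly between
  the spectral radius and 1.\<close>

lemma summable_funpow_if_spectral_radius_less_1:
  assumes f: "bounded_linear f" and "spectral_radius f < 1"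
  shows "summable (\<lambda>s. (f ^^ s) X)"
proof -
  obtain q where q: "spectral_radius f < q" "q < 1" using dense assms by blast
  \<comment> \<open>\<open>q \<ge> 0\<close> is carried along because \<open>q\<close> exceeds a
    root of a nonnegative number as soon as one such \<open>s\<close> is available.\<close>
  have ev: "\<forall>\<^sub>F s in sequentially. norm ((f ^^ s) X) \<le> q ^ s * norm X \<and> q \<ge> 0"
    using order_tendstoD(2)[OF spectral_radius_LIMSEQ[OF f] q(1)] eventually_ge_at_top[of 1]
  proof eventually_elim
    case (elim s)
    have nonneg: "0 \<le> onorm (f ^^ s)" by (rule onorm_pos_le[OF bounded_linear_funpow[OF f]])
    then have "root s (onorm (f ^^ s)) ^ s \<le> q ^ s"
      using elim by (intro power_mono) auto
    then have "onorm (f ^^ s) \<le> q ^ s"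
      using elim nonneg by (simp add: real_root_pow_pos2)
    then have "onorm (f ^^ s) * norm X \<le> q ^ s * norm X" by (rule mult_right_mono) simp
    moreover have "0 \<le> root s (onorm (f ^^ s))" using nonneg by (rule real_root_ge_zero)
    ultimately show ?case
      using onorm[OF bounded_linear_funpow[OF f], of s X] elim by linarith
  qed
  then have "q \<ge> 0"
    by (auto simp: eventually_sequentially)
  then have "summable (\<lambda>s. q ^ s * norm X)"
    using q by (intro summable_mult2 summable_geometric) simp
  then show ?thesis
    by (rule summable_comparison_test_ev[rotated]) (use ev in \<open>auto elim: eventually_mono\<close>)
qed

section \<open>The Neumann series of a positive map\<close>

lemma positive_op_suminf:
  assumes "summable g" "\<And>n. positive_op (g n)"
  shows "positive_op (suminf g)"
proof -
  \<comment> \<open>For fixed \<open>x\<close> the form is a bounded functional of the operator, so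
    it passes through the series.\<close>
  have "bounded_linear (\<lambda>A. cinner (A \<odot> x) x)" for x :: 'a
  proof (rule bounded_linear_intro[where K = "norm x * norm x"])
    show "cmod (cinner (A \<odot> x) x) \<le> norm A * (norm x * norm x)" for A
      using order_trans[OF cinner_Cauchy_Schwarz mult_right_mono[OF norm_bop_apply], of x A x]
      by (simp add: mult_ac)
  qed (simp_all add: cinner_simps scaleR_conv_of_real)
  then have sums: "(\<lambda>n. cinner (g n \<odot> x) x) sums cinner (suminf g \<odot> x) x" for x
    by (intro bounded_linear.sums[OF _ summable_sums] assms)
  have "0 \<le> Re (cinner (suminf g \<odot> x) x)" for x
    by (rule sums_le[OF _ sums_zero sums_Re[OF sums]]) (rule positive_opD(1)[OF assms(2)])
  moreover have "Im (cinner (suminf g \<odot> x) x) = 0" for x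
    using sums_Im[OF sums, of x] by (simp add: positive_opD(2)[OF assms(2)] sums_unique2[OF _ sums_zero])
  ultimately show ?thesis by (simp add: positive_op_iff)
qed

text \<open>\<open>N\<close> is the Neumann series. Its tail after the first term equals
  \<open>f (N X)\<close>, which gives the right inverse, and consists of positive terms when
  \<open>X\<close> is positive, which gives \<open>N X \<ge> X\<close>.\<close>

lemma positive_linear_map_resolvent:
  assumes f: "positive_linear_map f" and "spectral_radius f < 1"
  obtains N where "(\<lambda>X. X - f X) \<circ> N = id" "N \<circ> (\<lambda>X. X - f X) = id"
    "\<And>X. positive_op X \<Longrightarrow> positive_op (N X - X)"
proof
  have bl: "bounded_linear f" by (rule positive_linear_map_bounded_linear[OF f])
  define N where "N X = (\<Sum>s. (f ^^ s) X)" for X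
  have sm: "summable (\<lambda>s. (f ^^ s) X)" for X
    by (rule summable_funpow_if_spectral_radius_less_1[OF bl assms(2)])
  have tail: "(\<Sum>s. (f ^^ Suc s) X) = N X - X" for X
    using suminf_split_head[OF sm, of X] by (simp add: N_def)
  have sm': "summable (\<lambda>s. (f ^^ Suc s) X)" for X
    using sm[of X] by (subst summable_Suc_iff)
  have "f (N X) = N X - X" for X
    unfolding tail[symmetric] using bounded_linear.suminf[OF bl sm, of X] by (simp add: N_def)
  then show "(\<lambda>X. X - f X) \<circ> N = id" by auto
  \<comment> \<open>The series telescopes.\<close>
  have "N (X - f X) = X" for X
  proof -
    have "(f ^^ s) (X - f X) = (f ^^ s) X - (f ^^ Suc s) X" for s
      by (simp only: positive_linear_map_diff[OF positive_linear_map_funpow[OF f]] funpow_Suc_right comp_apply)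
    then have "N (X - f X) = N X - (\<Sum>s. (f ^^ Suc s) X)"
      unfolding N_def by (simp only: suminf_diff[OF sm sm'])
    then show ?thesis by (simp only: tail) simp
  qed
  then show "N \<circ> (\<lambda>X. X - f X) = id" by auto
  show "positive_op (N X - X)" if "positive_op X" for X
    unfolding tail[symmetric]
    by (intro positive_op_suminf sm' positive_linear_mapD(4)[OF positive_linear_map_funpow[OF f]] that)
qed

section \<open>Similarity and the spectral radius\<close>

lemma conjugate_cancel:
  assumes "R * S = 1"
  shows "R * (S * X * adj S) * adj R = X"
proof -
  have "R * (S * X * adj S) * adj R = (R * S) * X * adj (R * S)"
    by (simp only: adj_mult mult.assoc)
  then show ?thesis by (simp add: assms)
qed

lemma spectral_radius_less_1_if_similar:
  assumes \<phi>: "positive_linear_map \<phi>" and \<psi>: "positive_linear_map \<psi>" and "invertible_op R"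
    and sim: "\<And>X. \<phi> (R * X * adj R) = R * \<psi> X * adj R"
    and less: "\<psi> 1 \<lless> 1"
  shows "spectral_radius \<phi> < 1"
proof -
  obtain S where S: "R * S = 1" using assms by (auto simp: invertible_op_def)
  have "positive_op (1 - \<psi> 1)" "invertible_op (1 - \<psi> 1)"
    using less by (auto simp: op_less_def)
  then obtain \<delta> where \<delta>: "\<delta> > 0" "positive_op (1 - \<psi> 1 - \<delta> *\<^sub>R 1)"
    by (rule positive_invertible_lower_bound)
  \<comment> \<open>On the zero space \<open>\<delta>\<close> can exceed 1; the maximum keeps
    \<open>q\<close> nonnegative.\<close>
  define q where "q = max 0 (1 - \<delta>)"
  have q: "0 \<le> q" "q < 1" using \<delta> by (auto simp: q_def)
  have "q *\<^sub>R 1 - \<psi> 1 = (1 - \<psi> 1 - \<delta> *\<^sub>R 1) + (q - (1 - \<delta>)) *\<^sub>R 1"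
    by (simp add: algebra_simps)
  moreover have "positive_op ((1 - \<psi> 1 - \<delta> *\<^sub>R 1) + (q - (1 - \<delta>)) *\<^sub>R 1)"
    by (intro positive_op_add \<delta> positive_op_scaleR positive_op_1) (simp add: q_def)
  ultimately have step: "positive_op (q *\<^sub>R 1 - \<psi> 1)" by (simp only:)
  have pow: "positive_linear_map (\<psi> ^^ s)" for s by (rule positive_linear_map_funpow[OF \<psi>])
  have iter: "positive_op (q ^ s *\<^sub>R 1 - (\<psi> ^^ s) 1)" for s
  proof (induction s)
    case (Suc s)
    \<comment> \<open>Inserting the term \<open>q ^ s *\<^sub>R \<psi> 1\<close> writes the next gap
      as a sum of two positive operators.\<close>
    have "q ^ Suc s *\<^sub>R 1 - (\<psi> ^^ Suc s) 1 =
      q ^ s *\<^sub>R (q *\<^sub>R 1 - \<psi> 1) + \<psi> (q ^ s *\<^sub>R 1 - (\<psi> ^^ s) 1)"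
      by (simp add: positive_linear_mapD[OF \<psi>] positive_linear_map_diff[OF \<psi>] scaleR_diff_right mult.commute)
    then show ?case
      using Suc q step by (simp add: positive_op_add positive_op_scaleR positive_linear_mapD(4)[OF \<psi>])
  qed simp
  have one: "norm ((\<psi> ^^ s) 1) \<le> q ^ s" for s
  proof -
    have "norm ((\<psi> ^^ s) 1) \<le> norm (q ^ s *\<^sub>R 1 :: 'a bop)"
      by (intro norm_le_if_op_between iter positive_linear_mapD(4)[OF pow] positive_op_1)
    also have "\<dots> \<le> q ^ s" using q mult_left_mono[OF norm_one_bop_le, of "q ^ s"] by simp
    finally show ?thesis .
  qed
  have \<psi>_bound: "norm ((\<psi> ^^ s) X) \<le> 6 * q ^ s * norm X" for s X
    by (rule order_trans[OF positive_linear_map_bound[OF pow]])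
      (intro mult_right_mono mult_left_mono one; simp)
  have sim_pow: "(\<phi> ^^ s) (R * X * adj R) = R * (\<psi> ^^ s) X * adj R" for s X
    by (induction s) (simp_all add: sim)
  \<comment> \<open>The norms of the four conjugating factors times the constant 6; the added 1
    ensures \<open>C > 0\<close> on the zero space as well.\<close>
  define C where "C = 1 + norm R * (6 * (norm S * norm (adj S))) * norm (adj R)"
  have "norm ((\<phi> ^^ s) X) \<le> C * q ^ s * norm X" for s X
  proof -
    \<comment> \<open>Every \<open>X\<close> has the form \<open>R * ?Y * adj R\<close>, so the
      similarity relation reaches all operators.\<close>
    let ?Y = "S * X * adj S"
    have "(\<phi> ^^ s) X = R * (\<psi> ^^ s) ?Y * adj R"
      using sim_pow[of s ?Y] by (simp only: conjugate_cancel[OF S])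
    also have "norm \<dots> \<le> norm R * norm ((\<psi> ^^ s) ?Y) * norm (adj R)"
      by (meson norm_mult_ineq mult_right_mono norm_ge_zero order_trans)
    also have "\<dots> \<le> norm R * (6 * q ^ s * (norm S * norm X * norm (adj S))) * norm (adj R)"
      using q by (intro mult_right_mono mult_left_mono order_trans[OF \<psi>_bound]
          order_trans[OF norm_mult_ineq] norm_mult_ineq) auto
    also have "\<dots> = (C - 1) * q ^ s * norm X" by (simp add: C_def)
    also have "\<dots> \<le> C * q ^ s * norm X" using q by (intro mult_right_mono) auto
    finally show ?thesis .
  qed
  moreover have "C > 0" unfolding C_def by (intro add_pos_nonneg) auto
  ultimately have "spectral_radius \<phi> \<le> q"
    using q by (intro spectral_radius_le positive_linear_map_bounded_linear \<phi>)
  then show ?thesis using q by simp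
qed

section \<open>Defect maps\<close>

lemma comp_commute_funpow:
  assumes "f \<circ> g = g \<circ> f"
  shows "f \<circ> g ^^ n = g ^^ n \<circ> f"
proof
  have "f (g x) = g (f x)" for x using fun_cong[OF assms, of x] by simp
  then show "(f \<circ> g ^^ n) x = (g ^^ n \<circ> f) x" for x by (induction n) simp_all
qed

lemma foldr_comp_Cons:
  "foldr (\<lambda>i. (\<circ>) (f i)) (a # xs) id x = f a (foldr (\<lambda>i. (\<circ>) (f i)) xs id x)"
  by simp

lemma comp_commute_foldr:
  assumes "\<And>i. i \<in> set xs \<Longrightarrow> h \<circ> f i = f i \<circ> h"
  shows "h \<circ> foldr (\<lambda>i. (\<circ>) (f i)) xs id = foldr (\<lambda>i. (\<circ>) (f i)) xs id \<circ> h"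
  using assms by (induction xs) (auto simp: fun_eq_iff)

lemma funpow_cancel:
  assumes "f \<circ> g = id" "p \<le> m"
  shows "(f ^^ p) ((g ^^ m) x) = (g ^^ (m - p)) x"
proof -
  have "(f ^^ p) ((g ^^ p) y) = y" for y
  proof (induction p arbitrary: y)
    case (Suc p)
    \<comment> \<open>The adjacent pair \<open>f (g _)\<close> in the middle is cancelled first, as
      only this one-sided identity is assumed.\<close>
    have "(f ^^ Suc p) ((g ^^ Suc p) y) = (f ^^ p) (f (g ((g ^^ p) y)))"
      by (simp only: funpow_Suc_right[of p f] funpow.simps(2)[of p g] comp_apply)
    then show ?case using Suc fun_cong[OF assms(1), of "(g ^^ p) y"] by simp
  qed simp
  moreover have "(g ^^ m) x = (g ^^ p) ((g ^^ (m - p)) x)"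
    using assms(2) by (simp flip: funpow_add comp_apply[of "g ^^ p"])
  ultimately show ?thesis by simp
qed

text \<open>The powers of the later \<open>D i\<close> move past those of \<open>N a\<close>, so
  that each \<open>D a ^^ p a\<close> meets its own \<open>N a ^^ m a\<close> and cancels
  \<open>p a\<close> of its factors.\<close>

lemma foldr_funpow_cancel:
  assumes inv: "\<And>i. i \<in> I \<Longrightarrow> D i \<circ> N i = id"
    and comm: "\<And>i j. i \<in> I \<Longrightarrow> j \<in> I \<Longrightarrow> D i \<circ> N j = N j \<circ> D i"
    and le: "\<And>i. i \<in> I \<Longrightarrow> p i \<le> m i" and "set xs \<subseteq> I"
  shows "foldr (\<lambda>i. (\<circ>) (D i ^^ p i)) xs id (foldr (\<lambda>i. (\<circ>) (N i ^^ m i)) xs id X) =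
    foldr (\<lambda>i. (\<circ>) (N i ^^ (m i - p i))) xs id X"
  using assms(4)
proof (induction xs)
  case (Cons a xs)
  have pow: "N a ^^ m a \<circ> D i ^^ p i = D i ^^ p i \<circ> N a ^^ m a" if "i \<in> set xs" for i
    using that Cons.prems by (intro comp_commute_funpow comp_commute_funpow[symmetric] comm) auto
  let ?F = "foldr (\<lambda>i. (\<circ>) (D i ^^ p i)) xs id" and ?G = "foldr (\<lambda>i. (\<circ>) (N i ^^ m i)) xs id"
  have "foldr (\<lambda>i. (\<circ>) (D i ^^ p i)) xs id \<circ> N a ^^ m a =
      N a ^^ m a \<circ> foldr (\<lambda>i. (\<circ>) (D i ^^ p i)) xs id"
    by (intro comp_commute_foldr[symmetric] pow)
  from fun_cong[OF this, of "?G X"] have "?F ((N a ^^ m a) (?G X)) = (N a ^^ m a) (?F (?G X))"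
    by (simp only: comp_apply)
  moreover have "?F (?G X) = foldr (\<lambda>i. (\<circ>) (N i ^^ (m i - p i))) xs id X"
    by (rule Cons.IH) (use Cons.prems in auto)
  moreover have "(D a ^^ p a) ((N a ^^ m a) Y) = (N a ^^ (m a - p a)) Y" for Y
    using Cons.prems by (intro funpow_cancel inv le) auto
  ultimately show ?case by (simp only: foldr_comp_Cons)
qed simp

text \<open>No factor takes an operator above \<open>X \<ge> 0\<close> below \<open>X\<close>. With
  \<open>X = 1\<close> this bounds below both the operator built from all powers and what remains of
  it after cancellation.\<close>

lemma positive_op_foldr_funpow:
  assumes N: "\<And>i X. i \<in> set xs \<Longrightarrow> positive_op X \<Longrightarrow> positive_op (N i X - X)"
    and X: "positive_op X"
  shows "positive_op (foldr (\<lambda>i. (\<circ>) (N i ^^ n i)) xs id X - X)"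
proof -
  have trans: "positive_op (Z - X)" if "positive_op (Y - X)" "positive_op (Z - Y)" for Y Z
    using positive_op_add[OF that] by simp
  have ge: "positive_op Y" if "positive_op (Y - X)" for Y
    using positive_op_add[OF that X] by simp
  have pow: "positive_op ((N i ^^ k) Y - X)" if "i \<in> set xs" "positive_op (Y - X)" for i k Y
    using that by (induction k) (auto intro: trans N ge)
  show ?thesis using pow by (induction xs) auto
qed

text \<open>Conjugation by \<open>R\<close> intertwines each \<open>id - \<Lambda> i\<close> with
  \<open>id - \<Phi> i\<close>, hence also all products of their powers.\<close>

lemma Delta_conjugate:
  assumes RS: "R * S = 1" "S * R = 1"
    and \<Lambda>: "\<And>i X. \<Lambda> i X = S * \<Phi> i (R * X * adj R) * adj S"
  shows "Delta k \<Lambda> p X = S * Delta k \<Phi> p (R * X * adj R) * adj S"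
proof -
  define c where "c X = R * X * adj R" for X
  have "c (X - \<Lambda> i X) = c X - \<Phi> i (c X)" for i X
    using conjugate_cancel[OF RS(1), of "\<Phi> i (c X)"]
    by (simp add: c_def \<Lambda> right_diff_distrib left_diff_distrib)
  then have pow: "c (((\<lambda>X. X - \<Lambda> i X) ^^ n) X) = ((\<lambda>X. X - \<Phi> i X) ^^ n) (c X)" for i n X
    by (induction n) simp_all
  have "c (foldr (\<lambda>i f. ((\<lambda>X. X - \<Lambda> i X) ^^ p i) \<circ> f) xs id X) =
    foldr (\<lambda>i f. ((\<lambda>X. X - \<Phi> i X) ^^ p i) \<circ> f) xs id (c X)" for xs
    by (induction xs) (simp_all add: pow)
  then have "c (Delta k \<Lambda> p X) = Delta k \<Phi> p (c X)" by (simp add: Delta_def)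
  then show ?thesis using conjugate_cancel[OF RS(2), of "Delta k \<Lambda> p X"] by (simp add: c_def)
qed

text \<open>The unit multi-index in direction \<open>j\<close> isolates a single first-order
  defect.\<close>

lemma Delta_unit:
  assumes "j \<in> {1..k}"
  shows "Delta k \<Lambda> (\<lambda>i. if i = j then 1 else 0) X = X - \<Lambda> j X"
proof -
  have out: "foldr (\<lambda>i f. ((\<lambda>X. X - \<Lambda> i X) ^^ (if i = j then 1 else 0)) \<circ> f) xs id = id"
    if "j \<notin> set xs" for xs
    using that by (induction xs) auto
  have "foldr (\<lambda>i f. ((\<lambda>X. X - \<Lambda> i X) ^^ (if i = j then 1 else 0)) \<circ> f) xs id = (\<lambda>X. X - \<Lambda> j X)"
    if "j \<in> set xs" "distinct xs" for xs
    using that by (induction xs) (auto simp: out)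
  from this[of "[1..<Suc k]"] show ?thesis
    using assms by (simp add: Delta_def del: upt_Suc)
qed

lemma exists_positive_defects:
  assumes \<Phi>: "commuting_positive_tuple k \<Phi>"
    and r: "\<forall>i\<in>{1..k}. spectral_radius (\<Phi> i) < 1"
  obtains Q where "positive_op (Q - 1)"
    "\<And>p. \<forall>i\<in>{1..k}. p i \<le> m i \<Longrightarrow> positive_op (Delta k \<Phi> p Q - 1)"
proof -
  define D where "D i X = X - \<Phi> i X" for i X
  have pos: "positive_linear_map (\<Phi> i)" if "i \<in> {1..k}" for i
    using \<Phi> that by (auto simp: commuting_positive_tuple_def)
  have "\<exists>N. D i \<circ> N = id \<and> N \<circ> D i = id \<and> (\<forall>X. positive_op X \<longrightarrow> positive_op (N X - X))"
    if "i \<in> {1..k}" for i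
    unfolding D_def[abs_def] by (rule positive_linear_map_resolvent[OF pos[OF that] bspec[OF r that]]) blast
  then obtain N where N: "\<And>i. i \<in> {1..k} \<Longrightarrow> D i \<circ> N i = id" "\<And>i. i \<in> {1..k} \<Longrightarrow> N i \<circ> D i = id"
    "\<And>i X. i \<in> {1..k} \<Longrightarrow> positive_op X \<Longrightarrow> positive_op (N i X - X)"
    by metis
  have "\<Phi> i (\<Phi> j X) = \<Phi> j (\<Phi> i X)" if "i \<in> {1..k}" "j \<in> {1..k}" for i j X
    using \<Phi> that by (auto simp: commuting_positive_tuple_def fun_eq_iff)
  then have DD: "D i (D j X) = D j (D i X)" if "i \<in> {1..k}" "j \<in> {1..k}" for i j X
    using that by (simp add: D_def positive_linear_map_diff pos)
  \<comment> \<open>Commutation passes from \<open>D j\<close> to its inverse: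
    \<open>N j \<circ> D j\<close> is inserted on the left, and \<open>D i\<close> and
    \<open>D j\<close> are exchanged.\<close>
  have DN: "D i \<circ> N j = N j \<circ> D i" if "i \<in> {1..k}" "j \<in> {1..k}" for i j
  proof
    fix X
    have "D i (N j X) = N j (D j (D i (N j X)))"
      using fun_cong[OF N(2)[OF that(2)], of "D i (N j X)"] by simp
    also have "\<dots> = N j (D i (D j (N j X)))" by (simp only: DD that)
    also have "\<dots> = N j (D i X)"
      using fun_cong[OF N(1)[OF that(2)], of X] by simp
    finally show "(D i \<circ> N j) X = (N j \<circ> D i) X" by simp
  qed
  let ?xs = "[1..<Suc k]"
  define Q where "Q = foldr (\<lambda>i. (\<circ>) (N i ^^ m i)) ?xs id 1"
  show ?thesis
  proof
    show "positive_op (Q - 1)"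
      unfolding Q_def by (rule positive_op_foldr_funpow) (auto intro: N)
    fix p assume p: "\<forall>i\<in>{1..k}. p i \<le> m i"
    have "Delta k \<Phi> p Q = foldr (\<lambda>i. (\<circ>) (D i ^^ p i)) ?xs id Q"
      by (simp add: Delta_def D_def[abs_def] del: upt_Suc)
    also have "\<dots> = foldr (\<lambda>i. (\<circ>) (N i ^^ (m i - p i))) ?xs id 1"
      unfolding Q_def by (rule foldr_funpow_cancel[where I = "{1..k}", OF N(1) DN]) (use p in auto)
    finally have eq: "Delta k \<Phi> p Q = foldr (\<lambda>i. (\<circ>) (N i ^^ (m i - p i))) ?xs id 1" .
    show "positive_op (Delta k \<Phi> p Q - 1)"
      unfolding eq by (rule positive_op_foldr_funpow) (auto intro: N)
  qed
qed

section \<open>The implications between the three statements\<close>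

lemma similar_to_defect_tuple:
  assumes \<Phi>: "commuting_positive_tuple k \<Phi>"
    and r: "\<forall>i\<in>{1..k}. spectral_radius (\<Phi> i) < 1"
  shows "\<exists>\<Lambda>. commuting_positive_tuple k \<Lambda> \<and> jointly_similar k \<Phi> \<Lambda> \<and> 1 \<in> C_greater k \<Lambda> m"
proof -
  obtain Q where Q: "positive_op (Q - 1)"
    and \<Delta>Q: "\<And>p. \<forall>i\<in>{1..k}. p i \<le> m i \<Longrightarrow> positive_op (Delta k \<Phi> p Q - 1)"
    by (rule exists_positive_defects[OF assms, of m]) blast
  obtain R where R: "self_adjoint R" "invertible_op R" "R * R = Q"
    using positive_op_square_root[of 1 Q] Q by auto
  obtain S where RS: "R * S = 1" "S * R = 1" using R by (auto simp: invertible_op_def)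
  have inv: "invertible_op S" using RS by (auto simp: invertible_op_def)
  \<comment> \<open>The tuple is dictated by similarity via \<open>R\<close>, with \<open>S\<close>
    the inverse of \<open>R\<close>.\<close>
  define \<Lambda> where "\<Lambda> i X = S * \<Phi> i (R * X * adj R) * adj S" for i X
  have \<Phi>_pos: "positive_linear_map (\<Phi> i)" if "i \<in> {1..k}" for i
    using \<Phi> that by (auto simp: commuting_positive_tuple_def)
  show ?thesis
  proof (intro exI conjI)
    have mult_scaleC: "A * (c *\<^sub>C B) = c *\<^sub>C (A * B)" "(c *\<^sub>C B) * A = c *\<^sub>C (B * A)"
      for A B :: "'a bop" and c
      by (rule bop_eqI, simp)+
    have "positive_linear_map (\<Lambda> i)" if "i \<in> {1..k}" for i
      unfolding \<Lambda>_def using \<Phi>_pos[OF that]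
      by (intro positive_linear_mapI)
        (simp_all add: positive_linear_mapD positive_op_conjugate distrib_left distrib_right mult_scaleC)
    \<comment> \<open>The inner conjugations cancel in both compositions, leaving the commutation of
      the \<open>\<Phi> i\<close>.\<close>
    moreover have "\<Lambda> i \<circ> \<Lambda> j = \<Lambda> j \<circ> \<Lambda> i" if "i \<in> {1..k}" "j \<in> {1..k}" for i j
      using \<Phi> that
      by (auto simp: \<Lambda>_def fun_eq_iff commuting_positive_tuple_def conjugate_cancel[OF RS(1)])
    ultimately show "commuting_positive_tuple k \<Lambda>"
      by (simp add: commuting_positive_tuple_def)
    show "jointly_similar k \<Phi> \<Lambda>"
      unfolding jointly_similar_def using R(2)
      by (intro exI[of _ R]) (simp add: \<Lambda>_def conjugate_cancel[OF RS(1)])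
    have "0 \<lless> Delta k \<Lambda> p 1" if "\<forall>i\<in>{1..k}. p i \<le> m i" for p
    proof -
      \<comment> \<open>Since \<open>R\<close> is self-adjoint, \<open>R * 1 * adj R\<close> is
        \<open>R * R = Q\<close>: the defects of \<open>1\<close> are the conjugated defects of
        \<open>Q\<close>.\<close>
      have "Delta k \<Lambda> p 1 = S * Delta k \<Phi> p Q * adj S"
        using Delta_conjugate[where \<Lambda> = \<Lambda> and \<Phi> = \<Phi>, OF RS \<Lambda>_def, of k p 1] R
        by (simp add: self_adjoint_def)
      moreover have "positive_op (Delta k \<Phi> p Q)"
        using positive_op_add[OF \<Delta>Q[OF that] positive_op_1] by simp
      moreover have "invertible_op (Delta k \<Phi> p Q)"
        using \<Delta>Q[OF that] by (intro invertible_op_if_bounded_below[of 1]) simp_all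
      ultimately show ?thesis
        by (simp add: op_less_0_iff positive_op_conjugate invertible_op_mult invertible_op_adj inv)
    qed
    then show "1 \<in> C_greater k \<Lambda> m" by (simp add: C_greater_def)
  qed
qed

text \<open>A unit multi-index is nonzero and lies below the constant 1, so it is among those
  tested. The order also asks for self-adjointness of \<open>\<Lambda> j 1\<close>, which positivity
  supplies.\<close>

lemma defect_tuple_unit_less:
  assumes \<Lambda>: "commuting_positive_tuple k \<Lambda>" "1 \<in> C_greater k \<Lambda> (\<lambda>_. 1)" and j: "j \<in> {1..k}"
  shows "\<Lambda> j 1 \<lless> 1"
proof -
  have "0 \<lless> Delta k \<Lambda> (\<lambda>i. if i = j then 1 else 0) 1"
    using \<Lambda>(2) j unfolding C_greater_def by auto
  then have "0 \<lless> 1 - \<Lambda> j 1" unfolding Delta_unit[OF j] .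
  moreover have "positive_linear_map (\<Lambda> j)"
    using \<Lambda>(1) j by (simp add: commuting_positive_tuple_def)
  then have "self_adjoint (\<Lambda> j 1)"
    by (rule positive_op_imp_self_adjoint[OF positive_linear_mapD(4)[OF _ positive_op_1]])
  moreover have "self_adjoint 1"
    by (simp add: self_adjoint_def)
  ultimately show ?thesis by (simp add: op_less_def)
qed

lemma similar_to_contractive_if_defect_tuples:
  assumes "\<forall>m :: nat \<Rightarrow> nat. (\<forall>i\<in>{1..k}. m i \<ge> 1) \<longrightarrow>
    (\<exists>\<Lambda>. commuting_positive_tuple k \<Lambda> \<and> jointly_similar k \<Phi> \<Lambda> \<and> 1 \<in> C_greater k \<Lambda> m)"
  shows "\<exists>\<Lambda>. commuting_positive_tuple k \<Lambda> \<and> jointly_similar k \<Phi> \<Lambda> \<and> (\<forall>i\<in>{1..k}. \<Lambda> i 1 \<lless> 1)"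
proof -
  have "\<exists>\<Lambda>. commuting_positive_tuple k \<Lambda> \<and> jointly_similar k \<Phi> \<Lambda> \<and> 1 \<in> C_greater k \<Lambda> (\<lambda>_. 1)"
    using assms by simp
  then show ?thesis using defect_tuple_unit_less by blast
qed

lemma spectral_radius_less_1_if_jointly_similar:
  assumes \<Phi>: "commuting_positive_tuple k \<Phi>"
    and "\<exists>\<Lambda>. commuting_positive_tuple k \<Lambda> \<and> jointly_similar k \<Phi> \<Lambda> \<and> (\<forall>i\<in>{1..k}. \<Lambda> i 1 \<lless> 1)"
  shows "\<forall>i\<in>{1..k}. spectral_radius (\<Phi> i) < 1"
proof
  fix i assume i: "i \<in> {1..k}"
  obtain \<Lambda> R where \<Lambda>: "commuting_positive_tuple k \<Lambda>" and R: "invertible_op R"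
    "\<And>X. \<Phi> i (R * X * adj R) = R * \<Lambda> i X * adj R" and less: "\<Lambda> i 1 \<lless> 1"
    using assms(2) i unfolding jointly_similar_def by blast
  have "positive_linear_map (\<Phi> i)" "positive_linear_map (\<Lambda> i)"
    using \<Phi> \<Lambda> i by (simp_all add: commuting_positive_tuple_def)
  then show "spectral_radius (\<Phi> i) < 1"
    using R less by (rule spectral_radius_less_1_if_similar)
qed

theorem theorem5p2:
  fixes k :: nat
    and \<Phi> :: "nat \<Rightarrow> 'h::complex_hilbert bop \<Rightarrow> 'h bop"
  assumes separable: "\<exists>D :: 'h set. countable D \<and> closure D = UNIV"
    and k: "k \<ge> 1"
    and \<Phi>: "commuting_positive_tuple k \<Phi>"
  shows
    "((\<forall>i\<in>{1..k}. spectral_radius (\<Phi> i) < 1) \<longleftrightarrow>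
      (\<exists>\<Lambda>. commuting_positive_tuple k \<Lambda> \<and> jointly_similar k \<Phi> \<Lambda> \<and>
           (\<forall>i\<in>{1..k}. \<Lambda> i 1 \<lless> 1)))
     \<and>
     ((\<forall>i\<in>{1..k}. spectral_radius (\<Phi> i) < 1) \<longleftrightarrow>
      (\<forall>m :: nat \<Rightarrow> nat. (\<forall>i\<in>{1..k}. m i \<ge> 1) \<longrightarrow>
        (\<exists>\<Lambda>. commuting_positive_tuple k \<Lambda> \<and> jointly_similar k \<Phi> \<Lambda> \<and>
             1 \<in> C_greater k \<Lambda> m)))"
proof -
  \<comment> \<open>The cycle from (i) to (iii) to (ii) and back to (i) yields both
    equivalences.\<close>
  note i_iii = similar_to_defect_tuple[OF \<Phi>]
    and iii_ii = similar_to_contractive_if_defect_tuples[of k \<Phi>]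
    and ii_i = spectral_radius_less_1_if_jointly_similar[OF \<Phi>]
  show ?thesis
    by (intro conjI iffI)
      (rule iii_ii, intro allI impI, erule i_iii, erule ii_i, intro allI impI, erule i_iii,
        rule ii_i, erule iii_ii)
qed

end
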